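(* Let $I=\{1,\dots,n\}$ be a finite set of agents, and let $X$ be a measurable space of states whose $\sigma$-algebra $\Sigma_X$ is generated by the singletons $\{x\}$, $x\in X$. Consider the language $\mathcal{L}_B^{[0,1]}(X,I)$ (primitive propositions $\Phi=X$, thresholds $\Theta=[0,1]$), and let $\mathscr{C}_X$ be the class of probability models $\mathcal{M}=((\Omega,(\mathit{Pr}_i)_{i\in I}),\pi)$ over $(X,I)$ such that $\{\pi(x) : x\in X\}$ partitions $\Omega$. Let $\bar{\mathcal{M}}$ be the universal probability model for $\mathscr{C}_X$ over $\mathcal{L}_B^{[0,1]}(X,I)$. Then the type space $\mathcal{T}_{\bar{\mathcal{M}}}$ (its state space $\{d_0(\bar\omega) : \bar\omega\in\bar\Omega\}$ being identified with $X$ by matching $d_0(\bar\omega)$ with the unique element of $X$ it contains) is universal for $X$; that is, for every type space $\mathcal{T}=(X,(T_i)_{i\in I},(\beta_i)_{i\in I})$ with state space $X$ there exists a unique type morphism from $\mathcal{T}$ to $\mathcal{T}_{\bar{\mathcal{M}}}$.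
   Context: **Measure theory.** A measurable space is a set $Y$ with a $\sigma$-algebra $\Sigma_Y$, whose elements are called events. $\Delta(Y)$ is the set of probability measures on $Y$ with the $\sigma$-algebra generated by the sets $\mathcal{B}^\theta(E)=\{\mu\in\Delta(Y):\mu(E)\ge\theta\}$, $\theta\in[0,1]$, $E\in\Sigma_Y$. Finite products carry the product $\sigma$-algebra. For $\mu\in\Delta(Y)$ and $A\subseteq Y$, $\mu^*(A)=\inf\{\mu(E):E\in\Sigma_Y,\ E\supseteq A\}$. Write $T=\prod_{i\in I}T_i$. **Type spaces.** A type space (over $I$) is $\mathcal{T}=(X,(T_i)_{i\in I},(\beta_i)_{i\in I})$ where $X$ and each $T_i$ are measurable spaces and each $\beta_i:T_i\to\Delta(X\times T)$ is a measurable function such that the marginal of $\beta_i(t_i)$ on $T_i$ is $\delta_{t_i}$ (for events $E\subseteq T_i$, $\delta_{t_i}(E)=1$ if $t_i\in E$ and $0$ otherwise). Given type spaces $\mathcal{T}=(X,(T_i),(\beta_i))$ and $\mathcal{T}'=(X,(T'_i),(\beta'_i))$ with the same state space, a profile of functions $f_i:T_i\to T_i'$ ($i\in I$) is a type morphism from $\mathcal{T}$ to $\mathcal{T}'$ if for each $i\in I$, $t_i\in T_i$ and each event $E\subseteq X\times T'$, $\beta_i'(f_i(t_i))(E)=\beta_i(t_i)(f^{-1}(E))$, where $f=(\mathrm{id}_X,f_1,\dots,f_n):X\times T\to X\times T'$ (this includes the requirement that $f^{-1}(E)$ is an event, so that the right-hand side is defined). A type space $\mathcal{T}^*$ with state space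 $X$ is universal for $X$ if for every type space $\mathcal{T}$ with state space $X$ there is a unique type morphism from $\mathcal{T}$ to $\mathcal{T}^*$. **Language and probability models.** For a set $\Phi$ of primitive propositions and $\Theta\subseteq[0,1]$, $\mathcal{L}_B^\Theta(\Phi,I)$ is the language generated by $\phi::=p\mid\lnot\phi\mid\phi\land\psi\mid B_i^\theta\phi$ with $p\in\Phi$, $i\in I$, $\theta\in\Theta$. A probability frame (over $I$) is $(\Omega,(\mathit{Pr}_i)_{i\in I})$ where $\Omega$ is a measurable space and each $\mathit{Pr}_i:\Omega\to\Delta(\Omega)$ is measurable with $\mathit{Pr}_i(\omega)^*(\mathit{Pr}_i^{-1}(\mathit{Pr}_i(\omega)))=1$ for all $\omega$. A probability model over $(\Phi,I)$ is $\mathcal{M}=((\Omega,(\mathit{Pr}_i)),\pi)$, a probability frame with a map $\pi:\Phi\to\Sigma_\Omega$. Truth sets are defined by $[\![p]\!]_{\mathcal M}=\pi(p)$, $[\![\lnot\phi]\!]_{\mathcal M}=\Omega\setminus[\![\phi]\!]_{\mathcal M}$, $[\![\phi\land\psi]\!]_{\mathcal M}=[\![\phi]\!]_{\mathcal M}\cap[\![\psi]\!]_{\mathcal M}$, $[\![B_i^\theta\phi]\!]_{\mathcal M}=\{\omega:\mathit{Pr}_i(\omega)([\![\phi]\!]_{\mathcal M})\ge\theta\}$. A set of formulas is satisfiable (in $\mathcal{M}$) if all its members are true at one common world of some probability model (of $\mathcal M$). A description is a satisfiable set $D$ of formulas such that for each formula $\phi$, $\phi\in D$ or $\lnot\phi\in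 D$. **Universal probability model.** For a class $\mathscr{C}$ of probability models over $(\Phi,I)$, the universal probability model for $\mathscr{C}$ over $\mathcal{L}_B^{[0,1]}(\Phi,I)$ is $\bar{\mathcal M}=((\bar\Omega,(\overline{\mathit{Pr}}_i)_{i\in I}),\bar\pi)$, where $\bar\Omega$ is the set of all $\mathcal{L}_B^{[0,1]}(\Phi,I)$-descriptions satisfiable in some model in $\mathscr{C}$; $\hat\phi=\{\bar\omega\in\bar\Omega:\phi\in\bar\omega\}$; $\Sigma_{\bar\Omega}$ is generated by the algebra $\{\hat\phi:\phi\in\mathcal{L}_B^{[0,1]}(\Phi,I)\}$; $\overline{\mathit{Pr}}_i(\bar\omega)$ is the unique probability measure on $\Sigma_{\bar\Omega}$ with $\overline{\mathit{Pr}}_i(\bar\omega)(\hat\phi)=\sup\{\theta\in[0,1]:B_i^\theta\phi\in\bar\omega\}$ for all $\phi$; and $\bar\pi(p)=\hat p$. **The type space $\mathcal{T}_{\mathcal M}$ of a probability model $\mathcal M$** (with respect to $\mathcal L=\mathcal{L}_B^\Theta(\Phi,I)$, $\Theta$ dense in $[0,1]$; here $\Theta=[0,1]$). For a world $\omega$ let $D(\omega)=\{\phi\in\mathcal L:\omega\in[\![\phi]\!]_{\mathcal M}\}$; let $d_0(\omega)\subseteq D(\omega)$ be its purely propositional formulas (Boolean combinations of primitive propositions), and $d_i(\omega)\subseteq D(\omega)$ its formulas that are Boolean combinations of formulas of the form $B_i^\theta\phi$. The state space is $S=\{d_0(\omega):\omega\in\Omega\}$ with the $\sigma$-algebra generated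 by the sets $E_0(\phi)=\{x\in S:\phi\in x\}$, $\phi\in\mathcal L$; the $i$-type space is $T_i=\{d_i(\omega):\omega\in\Omega\}$ with the $\sigma$-algebra generated by $E_i(\phi)=\{t_i\in T_i:\phi\in t_i\}$, $\phi\in\mathcal L$. For $(x,t)\in S\times T$ there is a unique description $D(x,t)\supseteq x\cup\bigcup_i t_i$; put $[\phi]=\{(x,t)\in S\times T:\phi\in D(x,t)\}$. Then $\beta_i(t_i)$ is the unique probability measure $\mu$ on $S\times T$ such that for all $\phi\in\mathcal L$ and $\theta\in\Theta$: $\mu([\phi])\ge\theta\iff B_i^\theta\phi\in t_i$. Set $\mathcal{T}_{\mathcal M}=(S,(T_i)_{i\in I},(\beta_i)_{i\in I})$. *)

theory Defs
  imports "HOL-Probability.Probability"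
begin

text \<open>
  Measurable spaces are rendered as \<open>'a measure\<close>, of which only \<open>space\<close> and \<open>sets\<close> are used.
  The space $\Delta(Y)$ is \<open>prob_algebra Y\<close>, the finite product $\prod_{i \in I} T_i$ is
  \<open>PiM UNIV T\<close>, and $\mu^*$ is \<open>outer_measure_of \<mu>\<close>. The agents are the elements of a finite
  type \<open>'i\<close>.
\<close>

section \<open>Type spaces\<close>

record ('x, 'i, 't) type_structure =
  states :: "'x measure"
  types :: "'i \<Rightarrow> 't measure"
  belief :: "'i \<Rightarrow> 't \<Rightarrow> ('x \<times> ('i \<Rightarrow> 't)) measure"

definition joint :: "('x, 'i, 't) type_structure \<Rightarrow> ('x \<times> ('i \<Rightarrow> 't)) measure" where
  "joint T = states T \<Otimes>\<^sub>M PiM UNIV (types T)"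

definition type_space :: "('x, 'i::finite, 't) type_structure \<Rightarrow> bool" where
  "type_space T \<longleftrightarrow> (\<forall>i.
     belief T i \<in> types T i \<rightarrow>\<^sub>M prob_algebra (joint T) \<and>
     (\<forall>t \<in> space (types T i).
        distr (belief T i t) (types T i) (\<lambda>z. snd z i) = return (types T i) t))"

definition morphism_map :: "('i \<Rightarrow> 't \<Rightarrow> 's) \<Rightarrow> 'x \<times> ('i \<Rightarrow> 't) \<Rightarrow> 'x \<times> ('i \<Rightarrow> 's)" where
  "morphism_map f = (\<lambda>(x, t). (x, \<lambda>i. f i (t i)))"

text \<open>
  The extensional function space makes a profile of functions \<open>f i\<close> on the carriers of the type
  spaces correspond to exactly one HOL function, so that uniqueness of morphisms is plain
  \<open>\<exists>!\<close>.
\<close>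

definition type_morphism ::
  "('x, 'i::finite, 't) type_structure \<Rightarrow> ('x, 'i, 's) type_structure \<Rightarrow> ('i \<Rightarrow> 't \<Rightarrow> 's) \<Rightarrow> bool"
where
  "type_morphism T T' f \<longleftrightarrow>
     (\<forall>i. f i \<in> space (types T i) \<rightarrow>\<^sub>E space (types T' i)) \<and>
     (\<forall>i. \<forall>t \<in> space (types T i). \<forall>E \<in> sets (joint T').
        morphism_map f -` E \<inter> space (joint T) \<in> sets (joint T) \<and>
        measure (belief T' i (f i t)) E =
          measure (belief T i t) (morphism_map f -` E \<inter> space (joint T)))"

text \<open>
  The type argument is the type from which the type sets of the competing type spaces are taken.
  The carriers \<open>space (types T i)\<close> are arbitrary subsets of it, so there is no loss in using a
  common type for the finitely many agents.
\<close>

definition universal_type_space ::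
  "'t itself \<Rightarrow> 'x measure \<Rightarrow> ('x, 'i::finite, 's) type_structure \<Rightarrow> bool"
where
  "universal_type_space TYPE('t) X U \<longleftrightarrow>
     type_space U \<and> sets (states U) = sets X \<and>
     (\<forall>T :: ('x, 'i, 't) type_structure.
        type_space T \<and> sets (states T) = sets X \<longrightarrow> (\<exists>!f. type_morphism T U f))"

text \<open>Transport of a type space along an identification of its state space with another set.\<close>

definition identify_states ::
  "('x \<Rightarrow> 'y) \<Rightarrow> ('x, 'i, 't) type_structure \<Rightarrow> ('y, 'i, 't) type_structure"
where
  "identify_states h T =
     (let Y = sigma (h ` space (states T)) ((`) h ` sets (states T)) in
      \<lparr> states = Y,
        types = types T,
        belief = (\<lambda>i t. distr (belief T i t) (Y \<Otimes>\<^sub>M PiM UNIV (types T)) (map_prod h id)) \<rparr>)"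


section \<open>Language and probability models\<close>

datatype ('p, 'i) formula =
    Prop 'p
  | Neg "('p, 'i) formula"
  | Conj "('p, 'i) formula" "('p, 'i) formula"
  | Bel 'i real "('p, 'i) formula"

inductive_set language :: "'p set \<Rightarrow> real set \<Rightarrow> ('p, 'i) formula set"
  for \<Phi> :: "'p set" and \<Theta> :: "real set"
where
  "p \<in> \<Phi> \<Longrightarrow> Prop p \<in> language \<Phi> \<Theta>"
| "\<phi> \<in> language \<Phi> \<Theta> \<Longrightarrow> Neg \<phi> \<in> language \<Phi> \<Theta>"
| "\<phi> \<in> language \<Phi> \<Theta> \<Longrightarrow> \<psi> \<in> language \<Phi> \<Theta> \<Longrightarrow> Conj \<phi> \<psi> \<in> language \<Phi> \<Theta>"
| "\<phi> \<in> language \<Phi> \<Theta> \<Longrightarrow> \<theta> \<in> \<Theta> \<Longrightarrow> Bel i \<theta> \<phi> \<in> language \<Phi> \<Theta>"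

inductive_set boolean_combinations :: "('p, 'i) formula set \<Rightarrow> ('p, 'i) formula set"
  for A :: "('p, 'i) formula set"
where
  "\<phi> \<in> A \<Longrightarrow> \<phi> \<in> boolean_combinations A"
| "\<phi> \<in> boolean_combinations A \<Longrightarrow> Neg \<phi> \<in> boolean_combinations A"
| "\<phi> \<in> boolean_combinations A \<Longrightarrow> \<psi> \<in> boolean_combinations A \<Longrightarrow>
     Conj \<phi> \<psi> \<in> boolean_combinations A"

record ('w, 'p, 'i) model_structure =
  worlds :: "'w measure"
  Pr :: "'i \<Rightarrow> 'w \<Rightarrow> 'w measure"
  interp :: "'p \<Rightarrow> 'w set"

definition probability_frame :: "'w measure \<Rightarrow> ('i::finite \<Rightarrow> 'w \<Rightarrow> 'w measure) \<Rightarrow> bool" where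
  "probability_frame \<Omega> P \<longleftrightarrow> (\<forall>i.
     P i \<in> \<Omega> \<rightarrow>\<^sub>M prob_algebra \<Omega> \<and>
     (\<forall>w \<in> space \<Omega>. outer_measure_of (P i w) (P i -` {P i w} \<inter> space \<Omega>) = 1))"

definition probability_model :: "'p set \<Rightarrow> ('w, 'p, 'i::finite) model_structure \<Rightarrow> bool" where
  "probability_model \<Phi> M \<longleftrightarrow>
     probability_frame (worlds M) (Pr M) \<and> (\<forall>p \<in> \<Phi>. interp M p \<in> sets (worlds M))"

primrec truth_set :: "('w, 'p, 'i) model_structure \<Rightarrow> ('p, 'i) formula \<Rightarrow> 'w set" where
  "truth_set M (Prop p) = interp M p"
| "truth_set M (Neg \<phi>) = space (worlds M) - truth_set M \<phi>"
| "truth_set M (Conj \<phi> \<psi>) = truth_set M \<phi> \<inter> truth_set M \<psi>"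
| "truth_set M (Bel i \<theta> \<phi>) = {w \<in> space (worlds M). measure (Pr M i w) (truth_set M \<phi>) \<ge> \<theta>}"

definition satisfiable_in :: "('w, 'p, 'i) model_structure \<Rightarrow> ('p, 'i) formula set \<Rightarrow> bool" where
  "satisfiable_in M D \<longleftrightarrow> (\<exists>w \<in> space (worlds M). \<forall>\<phi> \<in> D. w \<in> truth_set M \<phi>)"

definition theory_of ::
  "'p set \<Rightarrow> real set \<Rightarrow> ('w, 'p, 'i) model_structure \<Rightarrow> 'w \<Rightarrow> ('p, 'i) formula set"
where
  "theory_of \<Phi> \<Theta> M w = {\<phi> \<in> language \<Phi> \<Theta>. w \<in> truth_set M \<phi>}"

text \<open>
  In HOL, quantification over all models has to fix a type of worlds. The type of sets of formulas
  is large enough: \<open>canonical_worlds\<close> below shows that every world of every model, over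
  whatever type, has the same theory as some world of a model whose worlds are sets of formulas.
\<close>

type_synonym ('p, 'i) canonical_model = "(('p, 'i) formula set, 'p, 'i) model_structure"

definition satisfiable :: "'p set \<Rightarrow> ('p, 'i::finite) formula set \<Rightarrow> bool" where
  "satisfiable \<Phi> D \<longleftrightarrow>
     (\<exists>M :: ('p, 'i) canonical_model. probability_model \<Phi> M \<and> satisfiable_in M D)"

definition description :: "'p set \<Rightarrow> real set \<Rightarrow> ('p, 'i::finite) formula set \<Rightarrow> bool" where
  "description \<Phi> \<Theta> D \<longleftrightarrow>
     D \<subseteq> language \<Phi> \<Theta> \<and> satisfiable \<Phi> D \<and> (\<forall>\<phi> \<in> language \<Phi> \<Theta>. \<phi> \<in> D \<or> Neg \<phi> \<in> D)"

text \<open>The class $\mathscr{C}_X$; its worlds are taken from an arbitrary type \<open>'w\<close>.\<close>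

definition partition_models :: "'p set \<Rightarrow> ('w, 'p, 'i::finite) model_structure set" where
  "partition_models \<Phi> =
     {M. probability_model \<Phi> M \<and> inj_on (interp M) \<Phi> \<and>
         partition_on (space (worlds M)) (interp M ` \<Phi>)}"


section \<open>The universal probability model\<close>

definition universal_worlds ::
  "'p set \<Rightarrow> ('p, 'i::finite) canonical_model set \<Rightarrow> ('p, 'i) formula set set"
where
  "universal_worlds \<Phi> C = {D. description \<Phi> {0..1} D \<and> (\<exists>M \<in> C. satisfiable_in M D)}"

definition hat :: "('p, 'i) formula set set \<Rightarrow> ('p, 'i) formula \<Rightarrow> ('p, 'i) formula set set" where
  "hat W \<phi> = {w \<in> W. \<phi> \<in> w}"

definition hat_space ::
  "'p set \<Rightarrow> real set \<Rightarrow> ('p, 'i) formula set set \<Rightarrow> ('p, 'i) formula set measure"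
where
  "hat_space \<Phi> \<Theta> W = sigma W (hat W ` language \<Phi> \<Theta>)"

definition universal_model ::
  "'p set \<Rightarrow> ('p, 'i::finite) canonical_model set \<Rightarrow> ('p, 'i) canonical_model"
where
  "universal_model \<Phi> C =
     (let W = universal_worlds \<Phi> C; \<Omega> = hat_space \<Phi> {0..1} W in
      \<lparr> worlds = \<Omega>,
        Pr = (\<lambda>i w. THE \<mu>. \<mu> \<in> space (prob_algebra \<Omega>) \<and>
               (\<forall>\<phi> \<in> language \<Phi> {0..1}.
                  measure \<mu> (hat W \<phi>) = Sup {\<theta> \<in> {0..1}. Bel i \<theta> \<phi> \<in> w})),
        interp = (\<lambda>p. hat W (Prop p)) \<rparr>)"


section \<open>The type space of a probability model\<close>

definition state_part ::
  "'p set \<Rightarrow> real set \<Rightarrow> ('w, 'p, 'i) model_structure \<Rightarrow> 'w \<Rightarrow> ('p, 'i) formula set"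
where
  "state_part \<Phi> \<Theta> M w = theory_of \<Phi> \<Theta> M w \<inter> boolean_combinations (range Prop)"

definition type_part ::
  "'p set \<Rightarrow> real set \<Rightarrow> ('w, 'p, 'i) model_structure \<Rightarrow> 'i \<Rightarrow> 'w \<Rightarrow> ('p, 'i) formula set"
where
  "type_part \<Phi> \<Theta> M i w =
     theory_of \<Phi> \<Theta> M w \<inter> boolean_combinations {Bel i \<theta> \<phi> | \<theta> \<phi>. True}"

definition joint_description ::
  "'p set \<Rightarrow> real set \<Rightarrow> ('p, 'i) formula set \<times> ('i::finite \<Rightarrow> ('p, 'i) formula set) \<Rightarrow>
     ('p, 'i) formula set"
where
  "joint_description \<Phi> \<Theta> z =
     (THE D. description \<Phi> \<Theta> D \<and> fst z \<union> (\<Union>i. snd z i) \<subseteq> D)"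

definition type_space_of ::
  "'p set \<Rightarrow> real set \<Rightarrow> ('w, 'p, 'i::finite) model_structure \<Rightarrow>
     (('p, 'i) formula set, 'i, ('p, 'i) formula set) type_structure"
where
  "type_space_of \<Phi> \<Theta> M =
     (let S = hat_space \<Phi> \<Theta> (state_part \<Phi> \<Theta> M ` space (worlds M));
          T = (\<lambda>i. hat_space \<Phi> \<Theta> (type_part \<Phi> \<Theta> M i ` space (worlds M)));
          ST = S \<Otimes>\<^sub>M PiM UNIV T
      in
      \<lparr> states = S,
        types = T,
        belief = (\<lambda>i t. THE \<mu>. \<mu> \<in> space (prob_algebra ST) \<and>
                   (\<forall>\<phi> \<in> language \<Phi> \<Theta>. \<forall>\<theta> \<in> \<Theta>.
                      measure \<mu> {z \<in> space ST. \<phi> \<in> joint_description \<Phi> \<Theta> z} \<ge> \<theta> \<longleftrightarrow>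
                      Bel i \<theta> \<phi> \<in> t)) \<rparr>)"

text \<open>The element of \<open>\<Phi>\<close> contained in a propositional state description.\<close>

definition state_of :: "'p set \<Rightarrow> ('p, 'i) formula set \<Rightarrow> 'p" where
  "state_of \<Phi> d = (THE x. x \<in> \<Phi> \<and> Prop x \<in> d)"

section \<open>Worlds as sets of formulas\<close>

lemma truth_set_sets:
  assumes M: "probability_model \<Phi> M" and "\<phi> \<in> language \<Phi> \<Theta>"
  shows "truth_set M \<phi> \<in> sets (worlds M)"
  using assms(2)
proof induction
  case (1 p)
  then show ?case using M by (simp add: probability_model_def)
next
  case (4 \<phi> \<theta> i)
  have "Pr M i \<in> worlds M \<rightarrow>\<^sub>M subprob_algebra (worlds M)"
    using M by (intro measurable_prob_algebraD) (auto simp: probability_model_def probability_frame_def)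
  from measurable_compose[OF this measurable_measure_subprob_algebra[OF 4(3)]]
  have [measurable]: "(\<lambda>w. measure (Pr M i w) (truth_set M \<phi>)) \<in> borel_measurable (worlds M)" .
  show ?case by simp
qed auto

lemma canonical_worlds:
  fixes M :: "('w, 'p, 'i::finite) model_structure"
  assumes M: "probability_model \<Phi> M"
  obtains M' :: "('p, 'i) canonical_model" where
    "probability_model \<Phi> M'"
    "M \<in> partition_models \<Phi> \<Longrightarrow> M' \<in> partition_models \<Phi>"
    "theory_of \<Phi> {0..1} M' ` space (worlds M') = theory_of \<Phi> {0..1} M ` space (worlds M)"
proof -
  let ?L = "language \<Phi> {0..1} :: ('p, 'i) formula set"
  let ?D = "theory_of \<Phi> {0..1} M"
  let ?\<Omega> = "space (worlds M)"
  define W where "W = ?D ` ?\<Omega>"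
  define Q where "Q = hat_space \<Phi> {0..1} W"
  define c where "c d = (SOME w. w \<in> ?\<Omega> \<and> ?D w = d)" for d
  define M' :: "('p, 'i) canonical_model" where
    "M' = \<lparr> worlds = Q, Pr = (\<lambda>i d. distr (Pr M i (c d)) Q ?D), interp = (\<lambda>p. hat W (Prop p)) \<rparr>"
  have c: "c d \<in> ?\<Omega>" "?D (c d) = d" if "d \<in> W" for d
    using that someI_ex[of "\<lambda>w. w \<in> ?\<Omega> \<and> ?D w = d"] by (auto simp: W_def c_def)
  have hat_W: "hat W ` ?L \<subseteq> Pow W" by (auto simp: hat_def)
  have space_Q: "space Q = W" and sets_Q: "sets Q = sigma_sets W (hat W ` ?L)"
    using hat_W by (auto simp: Q_def hat_space_def space_measure_of sets_measure_of)
  have vimage_hat: "?D -` hat W \<phi> \<inter> ?\<Omega> = truth_set M \<phi>" if "\<phi> \<in> ?L" for \<phi>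
    using that sets.sets_into_space[OF truth_set_sets[OF M that]]
    by (auto simp: hat_def W_def theory_of_def)
  have D_meas: "?D \<in> worlds M \<rightarrow>\<^sub>M Q"
    unfolding Q_def hat_space_def
    using hat_W by (rule measurable_measure_of) (auto simp: W_def vimage_hat[unfolded W_def] truth_set_sets[OF M])
  have Pr_in: "Pr M i w \<in> space (prob_algebra (worlds M))" if "w \<in> ?\<Omega>" for i w
    using M that by (auto simp: probability_model_def probability_frame_def dest: measurable_space)
  have Pr_prob: "prob_space (Pr M i w)" and Pr_sets: "sets (Pr M i w) = sets (worlds M)"
    and Pr_space: "space (Pr M i w) = ?\<Omega>" if "w \<in> ?\<Omega>" for i w
    using Pr_in[OF that] by (auto simp: space_prob_algebra dest: sets_eq_imp_space_eq)
  have D_meas_Pr: "?D \<in> Pr M i w \<rightarrow>\<^sub>M Q" if "w \<in> ?\<Omega>" for i w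
    using D_meas Pr_sets[OF that] by (simp cong: measurable_cong_sets)
  have distr_prob: "prob_space (distr (Pr M i w) Q ?D)" if "w \<in> ?\<Omega>" for i w
    using prob_space.prob_space_distr[OF Pr_prob D_meas_Pr] that by blast
  have hat_Q: "hat W \<phi> \<in> sets Q" if "\<phi> \<in> ?L" for \<phi>
    using that by (auto simp: sets_Q)
  have hat_measure: "measure (distr (Pr M i w) Q ?D) (hat W \<phi>) = measure (Pr M i w) (truth_set M \<phi>)"
    if "w \<in> ?\<Omega>" "\<phi> \<in> ?L" for i w \<phi>
    using that by (simp add: measure_distr D_meas_Pr hat_Q Pr_space vimage_hat)
  have hat_Conj: "hat W (Conj \<phi> \<psi>) = hat W \<phi> \<inter> hat W \<psi>" if "\<phi> \<in> ?L" "\<psi> \<in> ?L" for \<phi> \<psi>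
  proof -
    have Conj: "Conj \<phi> \<psi> \<in> ?L" using that by (intro language.intros)
    have "Conj \<phi> \<psi> \<in> d \<longleftrightarrow> \<phi> \<in> d \<and> \<psi> \<in> d" if d: "d \<in> W" for d
    proof -
      obtain w where w: "d = ?D w" using d by (auto simp: W_def)
      show ?thesis unfolding w theory_of_def using \<open>\<phi> \<in> ?L\<close> \<open>\<psi> \<in> ?L\<close> Conj by simp
    qed
    then show ?thesis unfolding hat_def by blast
  qed
  have stable: "Int_stable (hat W ` ?L)"
    by (rule Int_stableI) (auto simp flip: hat_Conj intro!: imageI intro: language.intros)
  have Pr_theory: "measure (Pr M i w) (truth_set M \<phi>) = measure (Pr M i v) (truth_set M \<phi>)"
    if wv: "w \<in> ?\<Omega>" "v \<in> ?\<Omega>" "?D w = ?D v" and \<phi>: "\<phi> \<in> ?L" for i w v \<phi>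
  proof -
    have *: "measure (Pr M i a) (truth_set M \<phi>) \<le> measure (Pr M i b) (truth_set M \<phi>)"
      if ab: "a \<in> ?\<Omega>" "b \<in> ?\<Omega>" "?D a = ?D b" for a b
    proof -
      let ?\<theta> = "measure (Pr M i a) (truth_set M \<phi>)"
      have "?\<theta> \<in> {0..1}" using prob_space.prob_le_1[OF Pr_prob[OF ab(1)]] by auto
      then have "Bel i ?\<theta> \<phi> \<in> ?D a"
        using \<phi> ab(1) by (auto simp: theory_of_def intro: language.intros)
      then have "Bel i ?\<theta> \<phi> \<in> ?D b" using ab(3) by simp
      then show ?thesis by (simp add: theory_of_def)
    qed
    show ?thesis using *[OF wv] *[of v w] wv by simp
  qed
  have distr_eq: "distr (Pr M i w) Q ?D = distr (Pr M i v) Q ?D"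
    if wv: "w \<in> ?\<Omega>" "v \<in> ?\<Omega>" "?D w = ?D v" for i w v
  proof (rule measure_eqI_generator_eq_countable[where A = "insert W {}" and E = "insert W (hat W ` ?L)" and \<Omega> = W])
    interpret w: prob_space "distr (Pr M i w) Q ?D" using distr_prob wv by blast
    interpret v: prob_space "distr (Pr M i v) Q ?D" using distr_prob wv by blast
    show "Int_stable (insert W (hat W ` ?L))"
    proof (rule Int_stableI)
      fix a b assume "a \<in> insert W (hat W ` ?L)" "b \<in> insert W (hat W ` ?L)"
      then consider "a = W" "b \<subseteq> W" | "b = W" "a \<subseteq> W" | "a \<in> hat W ` ?L" "b \<in> hat W ` ?L"
        using hat_W by auto
      then show "a \<inter> b \<in> insert W (hat W ` ?L)"
        using \<open>a \<in> insert W (hat W ` ?L)\<close> \<open>b \<in> insert W (hat W ` ?L)\<close>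
          Int_stableD[OF stable, of a b]
        by cases (auto simp: Int_absorb1 Int_absorb2)
    qed
    show "insert W (hat W ` ?L) \<subseteq> Pow W" using hat_W by auto
    have sig: "sigma_sets W (insert W (hat W ` ?L)) = sets Q"
      unfolding sets_Q
      by (intro antisym sigma_sets_mono subsetI)
         (auto intro: sigma_sets_top)
    show "sets (distr (Pr M i w) Q ?D) = sigma_sets W (insert W (hat W ` ?L))"
         "sets (distr (Pr M i v) Q ?D) = sigma_sets W (insert W (hat W ` ?L))"
      by (simp_all add: sig)
    fix a assume "a \<in> insert W (hat W ` ?L)"
    then show "emeasure (distr (Pr M i w) Q ?D) a = emeasure (distr (Pr M i v) Q ?D) a"
    proof
      assume "a = W"
      then show ?thesis using w.emeasure_space_1 v.emeasure_space_1 by (simp add: space_Q)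
    next
      assume "a \<in> hat W ` ?L"
      then show ?thesis
        using wv Pr_theory[OF wv] hat_measure
        by (auto simp: w.emeasure_eq_measure v.emeasure_eq_measure)
    qed
  qed (use finite_measure.emeasure_finite[OF prob_space.finite_measure[OF distr_prob[OF wv(1)]]] in auto)
  have Pr'_D: "Pr M' i (?D w) = distr (Pr M i w) Q ?D" if "w \<in> ?\<Omega>" for i w
    using distr_eq[of "c (?D w)" w i] c[of "?D w"] that by (simp add: M'_def W_def)
  have frame: "probability_frame (worlds M') (Pr M')"
    unfolding probability_frame_def
  proof (intro allI conjI ballI)
    fix i
    have "(\<lambda>d. Pr M' i d) \<in> Q \<rightarrow>\<^sub>M prob_algebra Q"
    proof (rule measurable_prob_algebra_generated[OF sets_Q stable hat_W])
      fix a assume "a \<in> space Q"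
      then show "prob_space (Pr M' i a)" "sets (Pr M' i a) = sets Q"
        using distr_prob c by (auto simp: M'_def space_Q)
    next
      fix A assume "A \<in> hat W ` ?L"
      then obtain \<phi> where \<phi>: "\<phi> \<in> ?L" "A = hat W \<phi>" by auto
      have eq: "emeasure (Pr M' i d) A = ennreal (measure (Pr M i (c d)) (truth_set M \<phi>))"
        if "d \<in> space Q" for d
      proof -
        have cd: "c d \<in> ?\<Omega>" using that c by (simp add: space_Q)
        interpret prob_space "distr (Pr M i (c d)) Q ?D" using distr_prob cd by blast
        show ?thesis using hat_measure[OF cd \<phi>(1)] \<phi>(2) by (simp add: M'_def emeasure_eq_measure)
      qed
      have "(\<lambda>d. measure (Pr M i (c d)) (truth_set M \<phi>)) \<in> borel_measurable Q"
        unfolding borel_measurable_iff_ge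
      proof
        fix \<theta> :: real
        consider "\<theta> < 0" | "\<theta> \<in> {0..1}" | "\<theta> > 1" by fastforce
        then show "{d \<in> space Q. \<theta> \<le> measure (Pr M i (c d)) (truth_set M \<phi>)} \<in> sets Q"
        proof cases
          case 1
          then have "{d \<in> space Q. \<theta> \<le> measure (Pr M i (c d)) (truth_set M \<phi>)} = space Q"
            by (auto intro: order_trans[OF less_imp_le measure_nonneg])
          then show ?thesis by simp
        next
          case 2
          have "{d \<in> space Q. \<theta> \<le> measure (Pr M i (c d)) (truth_set M \<phi>)} = hat W (Bel i \<theta> \<phi>)"
          proof -
            have "\<theta> \<le> measure (Pr M i (c d)) (truth_set M \<phi>) \<longleftrightarrow> Bel i \<theta> \<phi> \<in> d"
              if "d \<in> W" for d
            proof -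
              have "Bel i \<theta> \<phi> \<in> ?D (c d) \<longleftrightarrow> \<theta> \<le> measure (Pr M i (c d)) (truth_set M \<phi>)"
                using c(1)[OF that] 2 \<phi> by (auto simp: theory_of_def intro: language.intros)
              then show ?thesis using c(2)[OF that] by simp
            qed
            then show ?thesis by (auto simp: space_Q hat_def)
          qed
          then show ?thesis using 2 \<phi> by (auto intro!: hat_Q language.intros)
        next
          case 3
          have "measure (Pr M i (c d)) (truth_set M \<phi>) \<le> 1" if "d \<in> W" for d
            using prob_space.prob_le_1[OF Pr_prob] c(1)[OF that] by blast
          then have empty: "{d \<in> space Q. \<theta> \<le> measure (Pr M i (c d)) (truth_set M \<phi>)} = {}"
            using 3 by (force simp: space_Q)
          show ?thesis unfolding empty by simp
        qed
      qed
      then have "(\<lambda>d. ennreal (measure (Pr M i (c d)) (truth_set M \<phi>))) \<in> borel_measurable Q"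
        by measurable
      then show "(\<lambda>d. emeasure (Pr M' i d) A) \<in> borel_measurable Q"
        by (subst measurable_cong[OF eq]) auto
    qed
    then show "Pr M' i \<in> worlds M' \<rightarrow>\<^sub>M prob_algebra (worlds M')" by (simp add: M'_def)
    fix d assume "d \<in> space (worlds M')"
    then have d: "d \<in> W" by (simp add: M'_def space_Q)
    let ?w = "c d"
    interpret prob_space "distr (Pr M i ?w) Q ?D" using distr_prob c[OF d] by blast
    have Pr'_d: "Pr M' i d = distr (Pr M i ?w) Q ?D" by (simp add: M'_def)
    let ?K = "Pr M i -` {Pr M i ?w} \<inter> ?\<Omega>" and ?K' = "Pr M' i -` {Pr M' i d} \<inter> W"
    have "emeasure (Pr M' i d) B = 1" if B: "B \<in> sets (Pr M' i d)" "?K' \<subseteq> B" for B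
    proof (rule antisym)
      have BQ: "B \<in> sets Q" using B by (simp add: Pr'_d)
      have "?D v \<in> ?K'" if "v \<in> ?K" for v
        using that Pr'_D[of v i] Pr'_d by (auto simp: W_def)
      then have "?K \<subseteq> ?D -` B \<inter> ?\<Omega>" using B(2) by auto
      moreover have "?D -` B \<inter> ?\<Omega> \<in> sets (Pr M i ?w)"
        using measurable_sets[OF D_meas BQ] Pr_sets c(1)[OF d] by simp
      ultimately have "outer_measure_of (Pr M i ?w) ?K \<le> emeasure (Pr M i ?w) (?D -` B \<inter> ?\<Omega>)"
        unfolding outer_measure_of_def by (intro INF_lower) auto
      moreover have "outer_measure_of (Pr M i ?w) ?K = 1"
        using M c(1)[OF d] by (simp add: probability_model_def probability_frame_def)
      ultimately show "1 \<le> emeasure (Pr M' i d) B"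
        using c(1)[OF d] BQ by (simp add: Pr'_d emeasure_distr D_meas_Pr Pr_space)
      show "emeasure (Pr M' i d) B \<le> 1" using emeasure_le_1 by (simp add: Pr'_d)
    qed
    moreover have "W \<in> sets (Pr M' i d)" using sets.top[of Q] by (simp add: Pr'_d space_Q)
    ultimately have "outer_measure_of (Pr M' i d) ?K' = 1"
      unfolding outer_measure_of_def by (intro INF_eqI) (simp, metis (mono_tags, lifting) order_refl inf_le2 mem_Collect_eq)
    then show "outer_measure_of (Pr M' i d) (Pr M' i -` {Pr M' i d} \<inter> space (worlds M')) = 1"
      by (simp add: M'_def space_Q)
  qed
  have model: "probability_model \<Phi> M'"
    using frame hat_Q by (auto simp: probability_model_def M'_def intro: language.intros)
  have worlds_M': "space (worlds M') = W" by (simp add: M'_def space_Q)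
  have truth: "truth_set M' \<phi> = hat W \<phi>" if "\<phi> \<in> ?L" for \<phi>
    using that
  proof induction
    case (4 \<phi> \<theta> i)
    have Bel: "Bel i \<theta> \<phi> \<in> ?L" using 4 by (intro language.intros)
    have "\<theta> \<le> measure (Pr M' i (?D w)) (hat W \<phi>) \<longleftrightarrow> Bel i \<theta> \<phi> \<in> ?D w" if "w \<in> ?\<Omega>" for w
      using that 4 Bel by (simp add: Pr'_D hat_measure) (simp add: theory_of_def)
    then have "\<theta> \<le> measure (Pr M' i d) (hat W \<phi>) \<longleftrightarrow> Bel i \<theta> \<phi> \<in> d" if "d \<in> W" for d
      using that unfolding W_def by blast
    moreover have "truth_set M' (Bel i \<theta> \<phi>) = {d \<in> W. \<theta> \<le> measure (Pr M' i d) (hat W \<phi>)}"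
      using 4 worlds_M' by simp
    ultimately show ?case unfolding hat_def by blast
  next
    case (1 p)
    then show ?case by (simp add: M'_def)
  next
    case (2 \<phi>)
    have Neg: "Neg \<phi> \<in> ?L" using 2 by (intro language.intros)
    have "Neg \<phi> \<in> d \<longleftrightarrow> \<phi> \<notin> d" if d: "d \<in> W" for d
    proof -
      obtain w where w: "w \<in> ?\<Omega>" "d = ?D w" using d by (auto simp: W_def)
      show ?thesis unfolding w(2) theory_of_def using w(1) 2 Neg by simp
    qed
    moreover have "truth_set M' (Neg \<phi>) = W - hat W \<phi>" using 2 worlds_M' by simp
    ultimately show ?case unfolding hat_def by blast
  next
    case (3 \<phi> \<psi>)
    then show ?case by (simp add: hat_Conj)
  qed
  have "theory_of \<Phi> {0..1} M' d = d" if "d \<in> W" for d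
  proof -
    have "d \<subseteq> ?L" using that by (auto simp: W_def theory_of_def)
    moreover have "d \<in> truth_set M' \<phi> \<longleftrightarrow> \<phi> \<in> d" if "\<phi> \<in> ?L" for \<phi>
      using truth[OF that] \<open>d \<in> W\<close> by (simp add: hat_def)
    ultimately show ?thesis unfolding theory_of_def by blast
  qed
  then have theories: "theory_of \<Phi> {0..1} M' ` space (worlds M') = W"
    by (simp add: worlds_M')
  have partition: "M' \<in> partition_models \<Phi>" if "M \<in> partition_models \<Phi>"
  proof -
    have inj: "inj_on (interp M) \<Phi>" and part: "partition_on ?\<Omega> (interp M ` \<Phi>)"
      using that by (auto simp: partition_models_def)
    have unique: "p = q" if "p \<in> \<Phi>" "q \<in> \<Phi>" "w \<in> interp M p" "w \<in> interp M q" for p q w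
    proof -
      have "interp M p = interp M q"
        using part that unfolding partition_on_def disjoint_def by blast
      then show ?thesis using inj that by (simp add: inj_on_def)
    qed
    have mem: "?D w \<in> interp M' p \<longleftrightarrow> w \<in> interp M p" if "w \<in> ?\<Omega>" "p \<in> \<Phi>" for w p
      using that by (auto simp: M'_def hat_def W_def theory_of_def intro: language.intros)
    have sub: "interp M' p \<subseteq> ?D ` ?\<Omega>" for p by (auto simp: M'_def hat_def W_def)
    have nonempty: "\<exists>w \<in> ?\<Omega>. w \<in> interp M p" if "p \<in> \<Phi>" for p
      using part that unfolding partition_on_def by (metis UnionI all_not_in_conv image_eqI)
    have unique': "p = q" if "p \<in> \<Phi>" "q \<in> \<Phi>" "d \<in> interp M' p" "d \<in> interp M' q" for p q d
    proof -
      from that(3) sub obtain w where w: "w \<in> ?\<Omega>" "d = ?D w" by blast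
      show ?thesis using unique[of p q w] mem[of w p] mem[of w q] w that by simp
    qed
    have "inj_on (interp M') \<Phi>"
    proof (rule inj_onI)
      fix p q assume pq: "p \<in> \<Phi>" "q \<in> \<Phi>" "interp M' p = interp M' q"
      obtain w where "w \<in> ?\<Omega>" "w \<in> interp M p" using nonempty pq(1) by auto
      then show "p = q" using unique'[of p q "?D w"] mem[of w p] pq by simp
    qed
    moreover have "partition_on W (interp M' ` \<Phi>)"
    proof (rule partition_onI)
      show "\<Union>(interp M' ` \<Phi>) = W"
      proof
        show "\<Union>(interp M' ` \<Phi>) \<subseteq> W" using sub by (auto simp: W_def)
        show "W \<subseteq> \<Union>(interp M' ` \<Phi>)"
        proof
          fix d assume "d \<in> W"
          then obtain w where w: "w \<in> ?\<Omega>" "d = ?D w" by (auto simp: W_def)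
          then obtain p where "p \<in> \<Phi>" "w \<in> interp M p"
            using part unfolding partition_on_def by blast
          then show "d \<in> \<Union>(interp M' ` \<Phi>)" using mem[of w p] w by auto
        qed
      qed
      show "disjnt a b" if "a \<in> interp M' ` \<Phi>" "b \<in> interp M' ` \<Phi>" "a \<noteq> b" for a b
        using that unique' by (auto simp: disjnt_def)
      show "{} \<notin> interp M' ` \<Phi>"
      proof
        assume "{} \<in> interp M' ` \<Phi>"
        then obtain p where p: "p \<in> \<Phi>" "interp M' p = {}" by auto
        obtain w where "w \<in> ?\<Omega>" "w \<in> interp M p" using nonempty p(1) by auto
        then show False using mem[of w p] p by auto
      qed
    qed
    ultimately show ?thesis using model by (simp add: partition_models_def worlds_M')
  qed
  show ?thesis using that[OF model partition] theories by (simp add: W_def)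
qed

end

theory Submission
  imports Defs
begin

text \<open>
  Splitting a world's theory into its propositional part and its parts about the beliefs of the
  single agents identifies the worlds of the universal model with profiles in $S \times \prod_i T_i$.
  Truth of a formula at a profile can be read off syntactically, the sets of profiles at which a
  formula holds form an intersection-stable generator of the product \<open>\<sigma>\<close>-algebra, and the belief
  attached to a type is the image of the measure at any world, of any model, that realises the type.
  Conversely a type space is itself a model on $X \times T$: introspection for outer measure holds
  because resetting the own-type coordinate to \<open>t\<close> changes events only by null sets. Applied to the
  space of types under construction, this model shows that every profile is jointly satisfiable;
  applied to an arbitrary type space, its theory map is the required morphism. Any other morphism
  agrees with it by induction on formulas.
\<close>

section \<open>Probability measures and frames\<close>

text \<open>The obstacle is a circularity. In \<open>type_space_of\<close> the beliefs are definite
  descriptions that refer to \<open>joint_description\<close>, which makes sense only if a state and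
  types taken from different worlds can be realised together; but a world realising such a mixture
  is obtained from the type space itself. The circle is broken by \<open>holds_at\<close>, which
  presupposes no satisfiability: \<open>formula_space\<close> is built from it, shown to be a type
  space, turned into a model, and only then identified with \<open>type_space_of\<close>. All reals
  in [0,1] being thresholds, a belief can be compared with its exact value, so suprema of thresholds
  are attained. Generation of the events of \<open>X\<close> by singletons matches the fact that
  primitive propositions name single states: it makes the identification of states measurable in
  both directions.\<close>

lemma prob_measure_eqI_generator:
  assumes "prob_space M" "prob_space N"
    and E: "Int_stable E" "E \<subseteq> Pow \<Omega>"
    and sets: "sets M = sigma_sets \<Omega> E" "sets N = sigma_sets \<Omega> E"
    and eq: "\<And>A. A \<in> E \<Longrightarrow> measure M A = measure N A"
  shows "M = N"
\<comment> \<open>The generator need not contain \<open>\<Omega>\<close>, so it is adjoined; both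
  measures are 1 there.\<close>
proof (rule measure_eqI_generator_eq_countable[where A = "{\<Omega>}" and E = "insert \<Omega> E" and \<Omega> = \<Omega>])
  interpret M: prob_space M by fact
  interpret N: prob_space N by fact
  have space: "space M = \<Omega>" "space N = \<Omega>"
    using sets E(2) by (metis sets_measure_of space_measure_of sets_eq_imp_space_eq)+
  have "sigma_sets \<Omega> (insert \<Omega> E) = sigma_sets \<Omega> E"
    by (intro antisym sigma_sets_mono) (auto intro: sigma_sets_top)
  then show "sets M = sigma_sets \<Omega> (insert \<Omega> E)" "sets N = sigma_sets \<Omega> (insert \<Omega> E)"
    using sets by simp_all
  show "Int_stable (insert \<Omega> E)"
    using E by (intro Int_stableI) (auto simp: Int_absorb1 Int_absorb2 dest: Int_stableD)
  show "insert \<Omega> E \<subseteq> Pow \<Omega>" using E(2) by auto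
  show "emeasure M A = emeasure N A" if "A \<in> insert \<Omega> E" for A
    using that eq M.emeasure_space_1 N.emeasure_space_1 space
    by (auto simp: M.emeasure_eq_measure N.emeasure_eq_measure)
qed (auto simp: prob_space.finite_measure[OF assms(1), THEN finite_measure.emeasure_finite])

lemma outer_measure_of_eq_1I:
  assumes "prob_space \<mu>" "K \<subseteq> space \<mu>"
    and "\<And>B. B \<in> sets \<mu> \<Longrightarrow> K \<subseteq> B \<Longrightarrow> measure \<mu> B = 1"
  shows "outer_measure_of \<mu> K = 1"
proof -
  interpret prob_space \<mu> by fact
  show ?thesis
    unfolding outer_measure_of_def
    using assms(2,3) by (intro INF_eqI) (auto simp: emeasure_eq_measure)
qed

lemma probability_frame_Pr:
  assumes "probability_frame \<Omega> P" "w \<in> space \<Omega>"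
  shows "prob_space (P i w)" "sets (P i w) = sets \<Omega>" "space (P i w) = space \<Omega>"
proof -
  have "P i w \<in> space (prob_algebra \<Omega>)"
    using assms unfolding probability_frame_def by (blast intro: measurable_space)
  then show "prob_space (P i w)" and sets: "sets (P i w) = sets \<Omega>"
    by (auto simp: space_prob_algebra)
  show "space (P i w) = space \<Omega>" using sets by (rule sets_eq_imp_space_eq)
qed

text \<open>The worlds that share the belief of \<open>i\<close> at \<open>w\<close> need not form
  an event. The outer-measure condition becomes usable through events that cover them, and formulas
  about the beliefs of \<open>i\<close> will supply such events.\<close>

lemma probability_frame_introspection:
  assumes frame: "probability_frame \<Omega> P" and w: "w \<in> space \<Omega>" and A: "A \<in> sets \<Omega>"
    and sub: "\<And>v. v \<in> space \<Omega> \<Longrightarrow> P i v = P i w \<Longrightarrow> v \<in> A"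
  shows "measure (P i w) A = 1"
proof -
  interpret prob_space "P i w" by (rule probability_frame_Pr[OF frame w])
  have "outer_measure_of (P i w) (P i -` {P i w} \<inter> space \<Omega>) \<le> emeasure (P i w) A"
    unfolding outer_measure_of_def using A sub
    by (intro INF_lower) (auto simp: probability_frame_Pr[OF frame w])
  moreover have "outer_measure_of (P i w) (P i -` {P i w} \<inter> space \<Omega>) = 1"
    using frame w unfolding probability_frame_def by blast
  ultimately have "1 \<le> prob A" by (simp add: emeasure_eq_measure)
  then show ?thesis using prob_le_1 by (simp add: antisym)
qed

section \<open>Coordinates and events of the joint space\<close>

lemma space_joint: "space (joint T) = space (states T) \<times> (\<Pi>\<^sub>E i\<in>UNIV. space (types T i))"
  by (simp add: joint_def space_pair_measure space_PiM)

lemma measurable_state_coordinate: "fst \<in> joint T \<rightarrow>\<^sub>M states T"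
  by (simp add: joint_def)

lemma measurable_type_coordinate: "(\<lambda>z. snd z i) \<in> joint T \<rightarrow>\<^sub>M types T i"
  unfolding joint_def by measurable

lemma measurable_into_joint:
  assumes "(\<lambda>z. fst (f z)) \<in> M \<rightarrow>\<^sub>M states T" "\<And>i. (\<lambda>z. snd (f z) i) \<in> M \<rightarrow>\<^sub>M types T i"
  shows "f \<in> M \<rightarrow>\<^sub>M joint T"
proof -
  have "(\<lambda>z. (\<lambda>i. snd (f z) i)) \<in> M \<rightarrow>\<^sub>M PiM UNIV (types T)"
    by (rule measurable_PiM_single') (use assms(2) in \<open>auto dest: measurable_space\<close>)
  then have "(\<lambda>z. (fst (f z), snd (f z))) \<in> M \<rightarrow>\<^sub>M joint T"
    unfolding joint_def using assms(1) by (intro measurable_Pair) auto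
  then show ?thesis by simp
qed

text \<open>An induction principle for events: a property whose extension is a sigma-algebra needs
  checking only on events that depend on one coordinate. It amounts to measurability of the identity
  map out of the space equipped with \<open>A\<close>.\<close>

lemma sets_joint_least:
  assumes A: "sigma_algebra (space (joint T)) A"
    and states: "\<And>B. B \<in> sets (states T) \<Longrightarrow> {z \<in> space (joint T). fst z \<in> B} \<in> A"
    and types: "\<And>i B. B \<in> sets (types T i) \<Longrightarrow> {z \<in> space (joint T). snd z i \<in> B} \<in> A"
  shows "sets (joint T) \<subseteq> A"
proof -
  interpret A: sigma_algebra "space (joint T)" A by fact
  define N where "N = sigma (space (joint T)) A"
  have N: "space N = space (joint T)" "sets N = A"
    using A.space_closed by (auto simp: N_def A.sigma_sets_eq)
  have "(\<lambda>z. z) \<in> N \<rightarrow>\<^sub>M joint T"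
  proof (rule measurable_into_joint)
    show "fst \<in> N \<rightarrow>\<^sub>M states T"
    proof (rule measurableI)
      show "fst -` B \<inter> space N \<in> sets N" if "B \<in> sets (states T)" for B
        using states[OF that] by (simp add: N vimage_def Int_def conj_commute)
    qed (auto simp: N space_joint)
    show "(\<lambda>z. snd z i) \<in> N \<rightarrow>\<^sub>M types T i" for i
    proof (rule measurableI)
      show "(\<lambda>z. snd z i) -` B \<inter> space N \<in> sets N" if "B \<in> sets (types T i)" for B
        using types[OF that] by (simp add: N vimage_def Int_def conj_commute)
    qed (auto simp: N space_joint PiE_iff)
  qed
  then have "(\<lambda>z. z) -` B \<inter> space N \<in> sets N" if "B \<in> sets (joint T)" for B
    using that by (rule measurable_sets)
  then show ?thesis using sets.sets_into_space by (fastforce simp: N Int_absorb2)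
qed

text \<open>
  The marginal condition only determines the measure of events and the singleton of \<open>t\<close> need not be
  one; still, replacing the \<open>i\<close>-th coordinate by \<open>t\<close> alters no event by more than a null set.
\<close>

lemma AE_type_coordinate_replaced:
  fixes T :: "('x, 'i::finite, 't) type_structure"
  assumes \<mu>: "prob_space \<mu>" "sets \<mu> = sets (joint T)" and t: "t \<in> space (types T i)"
    and marginal: "distr \<mu> (types T i) (\<lambda>z. snd z i) = return (types T i) t"
    and E: "E \<in> sets (joint T)"
  shows "AE z in \<mu>. z \<in> E \<longleftrightarrow> (fst z, (snd z)(i := t)) \<in> E"
proof -
  interpret prob_space \<mu> by fact
  let ?c = "\<lambda>z. (fst z, (snd z)(i := t))"
  have space: "space \<mu> = space (joint T)" using \<mu>(2) by (rule sets_eq_imp_space_eq)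
  have c_space: "?c z \<in> space (joint T)" if "z \<in> space (joint T)" for z
    using that t by (auto simp: space_joint PiE_iff)
  let ?A = "{E \<in> sets (joint T). AE z in \<mu>. z \<in> E \<longleftrightarrow> ?c z \<in> E}"
  have "sigma_algebra (space (joint T)) ?A"
  proof (rule sigma_algebra_iff2[THEN iffD2], intro conjI ballI allI impI)
    show "?A \<subseteq> Pow (space (joint T))" using sets.sets_into_space by blast
    show "{} \<in> ?A" by simp
    show "space (joint T) - E \<in> ?A" if "E \<in> ?A" for E
    proof -
      have E: "E \<in> sets (joint T)" "AE z in \<mu>. z \<in> E \<longleftrightarrow> ?c z \<in> E" using that by auto
      have "AE z in \<mu>. z \<in> space (joint T) - E \<longleftrightarrow> ?c z \<in> space (joint T) - E"
        using E(2) AE_space by eventually_elim (use c_space space in auto)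
      then show ?thesis using E by auto
    qed
    show "(\<Union>n. F n) \<in> ?A" if "range F \<subseteq> ?A" for F :: "nat \<Rightarrow> _"
    proof -
      have "AE z in \<mu>. \<forall>n. z \<in> F n \<longleftrightarrow> ?c z \<in> F n"
        using that by (subst AE_all_countable) auto
      then have "AE z in \<mu>. z \<in> (\<Union>n. F n) \<longleftrightarrow> ?c z \<in> (\<Union>n. F n)"
        by eventually_elim auto
      moreover have "(\<Union>n. F n) \<in> sets (joint T)" using that by blast
      ultimately show ?thesis by auto
    qed
  qed
  then have "sets (joint T) \<subseteq> ?A"
  proof (rule sets_joint_least)
    fix B assume B: "B \<in> sets (states T)"
    have "{z \<in> space (joint T). fst z \<in> B} \<in> sets (joint T)"
      using measurable_sets[OF measurable_state_coordinate B] by (simp add: vimage_def Int_def conj_commute)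
    moreover have "AE z in \<mu>. z \<in> {z \<in> space (joint T). fst z \<in> B} \<longleftrightarrow>
        ?c z \<in> {z \<in> space (joint T). fst z \<in> B}"
      using AE_space by eventually_elim (use c_space space in auto)
    ultimately show "{z \<in> space (joint T). fst z \<in> B} \<in> ?A" by simp
  next
    fix j B assume B: "B \<in> sets (types T j)"
    have meas: "(\<lambda>z. snd z i) \<in> \<mu> \<rightarrow>\<^sub>M types T i"
      unfolding measurable_cong_sets[OF \<mu>(2) refl] by (rule measurable_type_coordinate)
    have "AE z in \<mu>. snd z j \<in> B \<longleftrightarrow> snd (?c z) j \<in> B"
    proof (cases "j = i")
      case True
      \<comment> \<open>For each fixed \<open>B\<close>, almost every \<open>s\<close> under the
        point mass at \<open>t\<close> agrees with \<open>t\<close> about membership in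
        \<open>B\<close>, whether or not the singleton of \<open>t\<close> is an event. The marginal
        condition carries this over to \<open>\<mu>\<close>.\<close>
      have "Measurable.pred (types T i) (\<lambda>s. s \<in> B \<longleftrightarrow> t \<in> B)"
        using B unfolding True by (cases "t \<in> B") auto
      then have "AE s in return (types T i) t. s \<in> B \<longleftrightarrow> t \<in> B"
        by (simp add: AE_return[OF t])
      then have "AE s in distr \<mu> (types T i) (\<lambda>z. snd z i). s \<in> B \<longleftrightarrow> t \<in> B"
        unfolding marginal .
      then show ?thesis
        using True \<open>Measurable.pred _ _\<close> by (subst (asm) AE_distr_iff[OF meas]) (auto simp: pred_def)
    qed simp
    then have "AE z in \<mu>. z \<in> {z \<in> space (joint T). snd z j \<in> B} \<longleftrightarrow>
        ?c z \<in> {z \<in> space (joint T). snd z j \<in> B}"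
      using AE_space by eventually_elim (use c_space space in auto)
    moreover have "{z \<in> space (joint T). snd z j \<in> B} \<in> sets (joint T)"
      using measurable_sets[OF measurable_type_coordinate B] by (simp add: vimage_def Int_def conj_commute)
    ultimately show "{z \<in> space (joint T). snd z j \<in> B} \<in> ?A" by simp
  qed
  then show ?thesis using E by blast
qed

lemma type_space_belief:
  assumes "type_space T" "t \<in> space (types T i)"
  shows "prob_space (belief T i t)" "sets (belief T i t) = sets (joint T)"
    "space (belief T i t) = space (joint T)"
proof -
  have "belief T i t \<in> space (prob_algebra (joint T))"
    using assms unfolding type_space_def by (blast intro: measurable_space)
  then show "prob_space (belief T i t)" and sets: "sets (belief T i t) = sets (joint T)"
    by (auto simp: space_prob_algebra)
  show "space (belief T i t) = space (joint T)" using sets by (rule sets_eq_imp_space_eq)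
qed

lemma type_space_probability_frame:
  fixes T :: "('x, 'i::finite, 't) type_structure"
  assumes T: "type_space T"
  shows "probability_frame (joint T) (\<lambda>i z. belief T i (snd z i))"
  unfolding probability_frame_def
proof (intro allI conjI ballI)
  fix i
  show "(\<lambda>z. belief T i (snd z i)) \<in> joint T \<rightarrow>\<^sub>M prob_algebra (joint T)"
    using T unfolding type_space_def
    by (intro measurable_compose[OF measurable_type_coordinate]) blast
  fix z assume z: "z \<in> space (joint T)"
  then have t: "snd z i \<in> space (types T i)" by (auto simp: space_joint)
  let ?\<mu> = "belief T i (snd z i)"
  note \<mu> = type_space_belief[OF T t]
  interpret prob_space ?\<mu> by (rule \<mu>)
  show "outer_measure_of ?\<mu> ((\<lambda>z. belief T i (snd z i)) -` {?\<mu>} \<inter> space (joint T)) = 1"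
  proof (rule outer_measure_of_eq_1I)
    fix B assume B: "B \<in> sets ?\<mu>" "(\<lambda>z. belief T i (snd z i)) -` {?\<mu>} \<inter> space (joint T) \<subseteq> B"
    have "AE v in ?\<mu>. v \<in> B \<longleftrightarrow> (fst v, (snd v)(i := snd z i)) \<in> B"
      using T t B \<mu> unfolding type_space_def
      by (intro AE_type_coordinate_replaced[OF \<mu>(1,2) t]) auto
    \<comment> \<open>The reset profile has own type \<open>snd z i\<close> and hence belief
      \<open>?\<mu>\<close>, so it lies in the fibre and therefore in \<open>B\<close>; the
      equivalence transfers this to \<open>v\<close>.\<close>
    then have "AE v in ?\<mu>. v \<in> B"
      using AE_space by eventually_elim (use B t \<mu>(3) in \<open>auto simp: space_joint PiE_iff\<close>)
    then show "prob B = 1" using B by (simp add: prob_eq_1)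
  qed (use \<mu> in auto)
qed

section \<open>Theories of worlds\<close>

abbreviation (input) full_language :: "'p set \<Rightarrow> ('p, 'i) formula set" where
  "full_language \<Phi> \<equiv> language \<Phi> {0..1}"

definition prop_formulas :: "('p, 'i) formula set" where
  "prop_formulas = boolean_combinations (range Prop)"

definition belief_formulas :: "'i \<Rightarrow> ('p, 'i) formula set" where
  "belief_formulas i = boolean_combinations {Bel i \<theta> \<phi> | \<theta> \<phi>. True}"

inductive_simps language_simps [simp]:
  "Prop p \<in> language \<Phi> \<Theta>" "Neg \<phi> \<in> language \<Phi> \<Theta>"
  "Conj \<phi> \<psi> \<in> language \<Phi> \<Theta>" "Bel i \<theta> \<phi> \<in> language \<Phi> \<Theta>"

inductive_simps boolean_combinations_simps:
  "Prop p \<in> boolean_combinations A" "Neg \<phi> \<in> boolean_combinations A"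
  "Conj \<phi> \<psi> \<in> boolean_combinations A" "Bel i \<theta> \<phi> \<in> boolean_combinations A"

lemma prop_formulas_simps [simp]:
  "Prop p \<in> prop_formulas"
  "Neg \<phi> \<in> prop_formulas \<longleftrightarrow> \<phi> \<in> prop_formulas"
  "Conj \<phi> \<psi> \<in> prop_formulas \<longleftrightarrow> \<phi> \<in> prop_formulas \<and> \<psi> \<in> prop_formulas"
  "Bel i \<theta> \<phi> \<notin> prop_formulas"
  by (auto simp: prop_formulas_def boolean_combinations_simps)

lemma belief_formulas_simps [simp]:
  "Prop p \<notin> belief_formulas i"
  "Neg \<phi> \<in> belief_formulas i \<longleftrightarrow> \<phi> \<in> belief_formulas i"
  "Conj \<phi> \<psi> \<in> belief_formulas i \<longleftrightarrow> \<phi> \<in> belief_formulas i \<and> \<psi> \<in> belief_formulas i"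
  "Bel j \<theta> \<phi> \<in> belief_formulas i \<longleftrightarrow> j = i"
  by (auto simp: belief_formulas_def boolean_combinations_simps)

abbreviation (input) world_theories :: "'p set \<Rightarrow> ('p, 'i::finite) formula set set" where
  "world_theories \<Phi> \<equiv> universal_worlds \<Phi> (partition_models \<Phi>)"

lemma partition_modelsD:
  assumes "M \<in> partition_models \<Phi>"
  shows "probability_model \<Phi> M" "probability_frame (worlds M) (Pr M)"
  using assms by (auto simp: partition_models_def probability_model_def)

text \<open>The worlds of \<open>M\<close> may have any type, whereas \<open>satisfiable\<close>
  quantifies over models whose worlds are sets of formulas; \<open>canonical_worlds\<close> bridges
  the gap. This later admits models whose worlds are profiles.\<close>

lemma description_theory_of:
  fixes M :: "('w, 'p, 'i::finite) model_structure"
  assumes M: "probability_model \<Phi> M" and w: "w \<in> space (worlds M)"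
  shows "description \<Phi> {0..1} (theory_of \<Phi> {0..1} M w)"
proof -
  obtain M' :: "('p, 'i) canonical_model" where M': "probability_model \<Phi> M'"
    "theory_of \<Phi> {0..1} M' ` space (worlds M') = theory_of \<Phi> {0..1} M ` space (worlds M)"
    using canonical_worlds[OF M] by metis
  have "theory_of \<Phi> {0..1} M w \<in> theory_of \<Phi> {0..1} M' ` space (worlds M')"
    unfolding M'(2) using w by (rule imageI)
  then obtain v where v: "v \<in> space (worlds M')"
    "theory_of \<Phi> {0..1} M w = theory_of \<Phi> {0..1} M' v" by auto
  have "satisfiable_in M' (theory_of \<Phi> {0..1} M' v)"
    using v(1) by (auto simp: satisfiable_in_def theory_of_def)
  then show ?thesis
    unfolding description_def satisfiable_def
    using M'(1) v by (auto simp: theory_of_def)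
qed

lemma theory_of_in_world_theories:
  fixes M :: "('w, 'p, 'i::finite) model_structure"
  assumes M: "M \<in> partition_models \<Phi>" and w: "w \<in> space (worlds M)"
  shows "theory_of \<Phi> {0..1} M w \<in> world_theories \<Phi>"
proof -
  note model = partition_modelsD(1)[OF M]
  obtain M' :: "('p, 'i) canonical_model" where M': "M' \<in> partition_models \<Phi>"
    "theory_of \<Phi> {0..1} M' ` space (worlds M') = theory_of \<Phi> {0..1} M ` space (worlds M)"
    using canonical_worlds[OF model] M by metis
  have "theory_of \<Phi> {0..1} M w \<in> theory_of \<Phi> {0..1} M' ` space (worlds M')"
    unfolding M'(2) using w by (rule imageI)
  then obtain v where v: "v \<in> space (worlds M')"
    "theory_of \<Phi> {0..1} M w = theory_of \<Phi> {0..1} M' v" by auto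
  have "satisfiable_in M' (theory_of \<Phi> {0..1} M' v)"
    using v(1) by (auto simp: satisfiable_in_def theory_of_def)
  then show ?thesis
    using M'(1) v description_theory_of[OF model w] by (auto simp: universal_worlds_def)
qed

text \<open>Maximality: a formula true at \<open>w\<close> but missing from \<open>D\<close> would
  have its negation in \<open>D\<close>, and the negation would be true at \<open>w\<close> as
  well.\<close>

lemma description_eq_theory_of:
  assumes D: "description \<Phi> \<Theta> D" and w: "w \<in> space (worlds M)" "\<forall>\<phi> \<in> D. w \<in> truth_set M \<phi>"
  shows "D = theory_of \<Phi> \<Theta> M w"
proof -
  have "\<phi> \<in> D" if "\<phi> \<in> language \<Phi> \<Theta>" "w \<in> truth_set M \<phi>" for \<phi>
    using that D bspec[OF w(2), of "Neg \<phi>"] by (auto simp: description_def)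
  then show ?thesis using D w(2) by (auto simp: theory_of_def description_def)
qed

lemma world_theoriesE:
  fixes D :: "('p, 'i::finite) formula set"
  assumes "D \<in> world_theories \<Phi>"
  obtains M :: "('p, 'i) canonical_model" and w where
    "M \<in> partition_models \<Phi>" "w \<in> space (worlds M)" "D = theory_of \<Phi> {0..1} M w"
  using assms unfolding universal_worlds_def satisfiable_in_def
  by (blast dest: description_eq_theory_of)

section \<open>Splitting descriptions\<close>

definition parts :: "('p, 'i) formula set \<Rightarrow> ('p, 'i) formula set \<times> ('i \<Rightarrow> ('p, 'i) formula set)" where
  "parts D = (D \<inter> prop_formulas, \<lambda>i. D \<inter> belief_formulas i)"

text \<open>
  Whether a formula belongs to the description determined by a profile \<open>z\<close> is decided by recursion
  on the Boolean structure alone; the profile need not come from a single world.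
\<close>

primrec holds_at ::
  "('p, 'i) formula set \<times> ('i \<Rightarrow> ('p, 'i) formula set) \<Rightarrow> ('p, 'i) formula \<Rightarrow> bool"
where
  "holds_at z (Prop p) \<longleftrightarrow> Prop p \<in> fst z"
| "holds_at z (Neg \<phi>) \<longleftrightarrow> \<not> holds_at z \<phi>"
| "holds_at z (Conj \<phi> \<psi>) \<longleftrightarrow> holds_at z \<phi> \<and> holds_at z \<psi>"
| "holds_at z (Bel i \<theta> \<phi>) \<longleftrightarrow> Bel i \<theta> \<phi> \<in> snd z i"

lemma holds_at_prop_cong:
  "\<phi> \<in> prop_formulas \<Longrightarrow> fst z = fst z' \<Longrightarrow> holds_at z \<phi> \<longleftrightarrow> holds_at z' \<phi>"
  unfolding prop_formulas_def by (induction rule: boolean_combinations.induct) auto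

lemma holds_at_belief_cong:
  "\<phi> \<in> belief_formulas i \<Longrightarrow> snd z i = snd z' i \<Longrightarrow> holds_at z \<phi> \<longleftrightarrow> holds_at z' \<phi>"
  unfolding belief_formulas_def by (induction rule: boolean_combinations.induct) auto

lemma holds_at_parts_theory_of:
  assumes "\<phi> \<in> language \<Phi> \<Theta>" and w: "w \<in> space (worlds M)"
  shows "holds_at (parts (theory_of \<Phi> \<Theta> M w)) \<phi> \<longleftrightarrow> w \<in> truth_set M \<phi>"
  using assms(1) by induction (use w in \<open>auto simp: parts_def theory_of_def\<close>)

lemma holds_at_parts:
  fixes D :: "('p, 'i::finite) formula set"
  assumes "D \<in> world_theories \<Phi>" "\<phi> \<in> full_language \<Phi>"
  shows "holds_at (parts D) \<phi> \<longleftrightarrow> \<phi> \<in> D"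
  using assms by (elim world_theoriesE) (simp add: holds_at_parts_theory_of, simp add: theory_of_def)

section \<open>Sigma-algebras generated by formulas\<close>

lemma space_hat_space [simp]: "space (hat_space \<Phi> \<Theta> W) = W"
  and sets_hat_space: "sets (hat_space \<Phi> \<Theta> W) = sigma_sets W (hat W ` language \<Phi> \<Theta>)"
proof -
  have "hat W ` language \<Phi> \<Theta> \<subseteq> Pow W" by (auto simp: hat_def)
  then show "space (hat_space \<Phi> \<Theta> W) = W"
    "sets (hat_space \<Phi> \<Theta> W) = sigma_sets W (hat W ` language \<Phi> \<Theta>)"
    by (simp_all add: hat_space_def)
qed

lemma hat_in_sets: "\<phi> \<in> language \<Phi> \<Theta> \<Longrightarrow> hat W \<phi> \<in> sets (hat_space \<Phi> \<Theta> W)"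
  by (auto simp: sets_hat_space)

lemma measurable_into_hat_space:
  assumes "\<And>v. v \<in> space M \<Longrightarrow> f v \<in> W"
    and "\<And>\<phi>. \<phi> \<in> language \<Phi> \<Theta> \<Longrightarrow> {v \<in> space M. \<phi> \<in> f v} \<in> sets M"
  shows "f \<in> M \<rightarrow>\<^sub>M hat_space \<Phi> \<Theta> W"
  unfolding hat_space_def
proof (rule measurable_measure_of)
  fix A assume "A \<in> hat W ` language \<Phi> \<Theta>"
  then obtain \<phi> where \<phi>: "\<phi> \<in> language \<Phi> \<Theta>" "A = hat W \<phi>" by auto
  have "f -` A \<inter> space M = {v \<in> space M. \<phi> \<in> f v}" using assms(1) \<phi>(2) by (auto simp: hat_def)
  then show "f -` A \<inter> space M \<in> sets M" using assms(2)[OF \<phi>(1)] by simp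
qed (use assms(1) in \<open>auto simp: hat_def\<close>)

definition formula_states :: "'p set \<Rightarrow> ('p, 'i::finite) formula set measure" where
  "formula_states \<Phi> = hat_space \<Phi> {0..1} ((\<lambda>D. fst (parts D)) ` world_theories \<Phi>)"

definition formula_types :: "'p set \<Rightarrow> 'i::finite \<Rightarrow> ('p, 'i) formula set measure" where
  "formula_types \<Phi> i = hat_space \<Phi> {0..1} ((\<lambda>D. snd (parts D) i) ` world_theories \<Phi>)"

definition formula_joint ::
  "'p set \<Rightarrow> (('p, 'i::finite) formula set \<times> ('i \<Rightarrow> ('p, 'i) formula set)) measure"
where
  "formula_joint \<Phi> = formula_states \<Phi> \<Otimes>\<^sub>M PiM UNIV (formula_types \<Phi>)"

definition holding ::
  "'p set \<Rightarrow> ('p, 'i::finite) formula \<Rightarrow> (('p, 'i) formula set \<times> ('i \<Rightarrow> ('p, 'i) formula set)) set"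
where
  "holding \<Phi> \<phi> = {z \<in> space (formula_joint \<Phi>). holds_at z \<phi>}"

text \<open>The condition that characterises the belief of a type, with \<open>holding\<close> in
  place of the profiles whose joint description contains the formula; it can thus be stated before
  joint descriptions are known to exist.\<close>

definition represents ::
  "'p set \<Rightarrow> 'i \<Rightarrow> ('p, 'i::finite) formula set \<Rightarrow>
     (('p, 'i) formula set \<times> ('i \<Rightarrow> ('p, 'i) formula set)) measure \<Rightarrow> bool"
where
  "represents \<Phi> i t \<mu> \<longleftrightarrow> \<mu> \<in> space (prob_algebra (formula_joint \<Phi>)) \<and>
     (\<forall>\<phi> \<in> full_language \<Phi>. \<forall>\<theta> \<in> {0..1}. measure \<mu> (holding \<Phi> \<phi>) \<ge> \<theta> \<longleftrightarrow> Bel i \<theta> \<phi> \<in> t)"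

definition formula_space ::
  "'p set \<Rightarrow> (('p, 'i::finite) formula set, 'i, ('p, 'i) formula set) type_structure"
where
  "formula_space \<Phi> =
     \<lparr> states = formula_states \<Phi>, types = formula_types \<Phi>,
       belief = (\<lambda>i t. THE \<mu>. represents \<Phi> i t \<mu>) \<rparr>"

lemma joint_formula_space: "joint (formula_space \<Phi>) = formula_joint \<Phi>"
  by (simp add: joint_def formula_space_def formula_joint_def)

lemma space_formula_joint:
  "z \<in> space (formula_joint \<Phi>) \<longleftrightarrow>
     fst z \<in> (\<lambda>D. fst (parts D)) ` world_theories \<Phi> \<and>
     (\<forall>i. snd z i \<in> (\<lambda>D. snd (parts D) i) ` world_theories \<Phi>)"
  by (cases z) (simp add: formula_joint_def formula_states_def formula_types_def space_pair_measure
      space_PiM PiE_iff)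

lemma parts_in_formula_joint: "D \<in> world_theories \<Phi> \<Longrightarrow> parts D \<in> space (formula_joint \<Phi>)"
  unfolding space_formula_joint by blast

text \<open>The components of \<open>z\<close> may stem from different worlds, but a propositional
  formula sees only the first one. So \<open>z\<close> can be exchanged for the parts of the world
  theory that supplies \<open>fst z\<close>, where \<open>holds_at\<close> is membership.\<close>

lemma holds_at_prop:
  assumes "\<phi> \<in> full_language \<Phi>" "fst z \<in> (\<lambda>D. fst (parts D)) ` world_theories \<Phi>"
  shows "\<phi> \<in> fst z \<longleftrightarrow> \<phi> \<in> prop_formulas \<and> holds_at z \<phi>"
proof -
  obtain D where D: "D \<in> world_theories \<Phi>" "fst z = fst (parts D)" using assms(2) by blast
  have "\<phi> \<in> fst z \<longleftrightarrow> \<phi> \<in> prop_formulas \<and> \<phi> \<in> D" unfolding D(2) by (auto simp: parts_def)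
  also have "\<dots> \<longleftrightarrow> \<phi> \<in> prop_formulas \<and> holds_at (parts D) \<phi>"
    using holds_at_parts[OF D(1) assms(1)] by simp
  also have "\<dots> \<longleftrightarrow> \<phi> \<in> prop_formulas \<and> holds_at z \<phi>"
    using holds_at_prop_cong[of \<phi> z "parts D"] D(2) by blast
  finally show ?thesis .
qed

lemma holds_at_belief:
  assumes "\<phi> \<in> full_language \<Phi>" "snd z i \<in> (\<lambda>D. snd (parts D) i) ` world_theories \<Phi>"
  shows "\<phi> \<in> snd z i \<longleftrightarrow> \<phi> \<in> belief_formulas i \<and> holds_at z \<phi>"
proof -
  obtain D where D: "D \<in> world_theories \<Phi>" "snd z i = snd (parts D) i" using assms(2) by blast
  have "\<phi> \<in> snd z i \<longleftrightarrow> \<phi> \<in> belief_formulas i \<and> \<phi> \<in> D" unfolding D(2) by (auto simp: parts_def)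
  also have "\<dots> \<longleftrightarrow> \<phi> \<in> belief_formulas i \<and> holds_at (parts D) \<phi>"
    using holds_at_parts[OF D(1) assms(1)] by simp
  also have "\<dots> \<longleftrightarrow> \<phi> \<in> belief_formulas i \<and> holds_at z \<phi>"
    using holds_at_belief_cong[of \<phi> i z "parts D"] D(2) by blast
  finally show ?thesis .
qed

lemma holding_Neg: "holding \<Phi> (Neg \<phi>) = space (formula_joint \<Phi>) - holding \<Phi> \<phi>"
  and holding_Conj: "holding \<Phi> (Conj \<phi> \<psi>) = holding \<Phi> \<phi> \<inter> holding \<Phi> \<psi>"
  by (auto simp: holding_def)

lemma holding_in_sets:
  fixes \<phi> :: "('p, 'i::finite) formula"
  shows "\<phi> \<in> full_language \<Phi> \<Longrightarrow> holding \<Phi> \<phi> \<in> sets (formula_joint \<Phi>)"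
proof (induction rule: language.induct)
  case (1 p)
  have "fst \<in> formula_joint \<Phi> \<rightarrow>\<^sub>M (formula_states \<Phi> :: ('p, 'i) formula set measure)" by (simp add: formula_joint_def)
  moreover let ?H = "hat ((\<lambda>D. fst (parts D)) ` (world_theories \<Phi> :: ('p, 'i) formula set set)) (Prop p)"
  have "?H \<in> sets (formula_states \<Phi>)"
    unfolding formula_states_def using 1 by (intro hat_in_sets) simp
  ultimately have "fst -` ?H \<inter> space (formula_joint \<Phi>) \<in> sets (formula_joint \<Phi>)"
    by (rule measurable_sets)
  moreover have "fst -` ?H \<inter> space (formula_joint \<Phi>) = holding \<Phi> (Prop p)"
    by (auto simp: hat_def holding_def space_formula_joint)
  ultimately show ?case by (simp only:)
next
  case (4 \<phi> \<theta> i)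
  have "(\<lambda>z. snd z i) \<in> formula_joint \<Phi> \<rightarrow>\<^sub>M formula_types \<Phi> i"
    unfolding formula_joint_def by measurable
  from measurable_sets[OF this[unfolded formula_types_def] hat_in_sets[of "Bel i \<theta> \<phi>"]]
  have "(\<lambda>z. snd z i) -` hat ((\<lambda>D. snd (parts D) i) ` world_theories \<Phi>) (Bel i \<theta> \<phi>) \<inter>
      space (formula_joint \<Phi>) \<in> sets (formula_joint \<Phi>)" using 4 by simp
  moreover have "(\<lambda>z. snd z i) -` hat ((\<lambda>D. snd (parts D) i) ` world_theories \<Phi>) (Bel i \<theta> \<phi>) \<inter>
      space (formula_joint \<Phi>) = holding \<Phi> (Bel i \<theta> \<phi>)"
    by (auto simp: hat_def holding_def space_formula_joint)
  ultimately show ?case by (simp only:)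
qed (auto simp: holding_Neg holding_Conj)

text \<open>A generating event of one coordinate pulls back to \<open>holding \<Phi> \<phi>\<close>,
  or to the empty set when \<open>\<phi>\<close> is not of the sort collected in that coordinate. So
  formulas about whole profiles generate the product sigma-algebra, and conjunction makes this
  generator closed under intersection.\<close>

lemma sets_formula_joint:
  "sets (formula_joint \<Phi>) = sigma_sets (space (formula_joint \<Phi>)) (holding \<Phi> ` full_language \<Phi>)"
    (is "sets ?J = sigma_sets _ ?G")
proof
  have G: "?G \<subseteq> Pow (space ?J)" by (auto simp: holding_def)
  define N where "N = sigma (space ?J) ?G"
  have N: "space N = space ?J" "sets N = sigma_sets (space ?J) ?G"
    using G by (simp_all add: N_def)
  have holding_N: "holding \<Phi> \<phi> \<in> sets N" if "\<phi> \<in> full_language \<Phi>" for \<phi>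
    using that by (auto simp: N)
  have "(\<lambda>z. z) \<in> N \<rightarrow>\<^sub>M joint (formula_space \<Phi>)"
  proof (rule measurable_into_joint)
    have "fst \<in> N \<rightarrow>\<^sub>M formula_states \<Phi>"
      unfolding formula_states_def
    proof (rule measurable_into_hat_space)
      fix \<phi> :: "('a, 'b) formula" assume \<phi>: "\<phi> \<in> full_language \<Phi>"
      have "{z \<in> space N. \<phi> \<in> fst z} = (if \<phi> \<in> prop_formulas then holding \<Phi> \<phi> else {})"
        using holds_at_prop[OF \<phi>] by (simp add: N holding_def space_formula_joint cong: conj_cong)
      then show "{z \<in> space N. \<phi> \<in> fst z} \<in> sets N" using holding_N[OF \<phi>] by simp
    qed (simp add: N space_formula_joint)
    then show "(\<lambda>z. fst z) \<in> N \<rightarrow>\<^sub>M states (formula_space \<Phi>)" by (simp add: formula_space_def)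
    fix i
    have "(\<lambda>z. snd z i) \<in> N \<rightarrow>\<^sub>M formula_types \<Phi> i"
      unfolding formula_types_def
    proof (rule measurable_into_hat_space)
      fix \<phi> :: "('a, 'b) formula" assume \<phi>: "\<phi> \<in> full_language \<Phi>"
      have "{z \<in> space N. \<phi> \<in> snd z i} = (if \<phi> \<in> belief_formulas i then holding \<Phi> \<phi> else {})"
        using holds_at_belief[OF \<phi>] by (simp add: N holding_def space_formula_joint cong: conj_cong)
      then show "{z \<in> space N. \<phi> \<in> snd z i} \<in> sets N" using holding_N[OF \<phi>] by simp
    qed (simp add: N space_formula_joint)
    then show "(\<lambda>z. snd z i) \<in> N \<rightarrow>\<^sub>M types (formula_space \<Phi>) i" by (simp add: formula_space_def)
  qed
  from measurable_sets[OF this] show "sets ?J \<subseteq> sigma_sets (space ?J) ?G"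
    using sets.sets_into_space by (fastforce simp: N joint_formula_space Int_absorb2)
  show "sigma_sets (space ?J) ?G \<subseteq> sets ?J"
    using holding_in_sets by (intro sets.sigma_sets_subset) auto
qed

lemma Int_stable_holding: "Int_stable (holding \<Phi> ` full_language \<Phi>)"
  by (rule Int_stableI) (auto simp flip: holding_Conj intro!: imageI)

lemma holding_subset: "holding \<Phi> ` full_language \<Phi> \<subseteq> Pow (space (formula_joint \<Phi>))"
  by (auto simp: holding_def)

lemma represents_unique:
  assumes "represents \<Phi> i t \<mu>" "represents \<Phi> i t \<nu>"
  shows "\<mu> = \<nu>"
proof (rule prob_measure_eqI_generator[OF _ _ Int_stable_holding holding_subset])
  show \<mu>: "prob_space \<mu>" and \<nu>: "prob_space \<nu>"
    using assms by (auto simp: represents_def space_prob_algebra)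
  show "sets \<mu> = sigma_sets (space (formula_joint \<Phi>)) (holding \<Phi> ` full_language \<Phi>)"
    "sets \<nu> = sigma_sets (space (formula_joint \<Phi>)) (holding \<Phi> ` full_language \<Phi>)"
    using assms by (auto simp: represents_def space_prob_algebra simp flip: sets_formula_joint)
  show "measure \<mu> A = measure \<nu> A" if A: "A \<in> holding \<Phi> ` full_language \<Phi>" for A
  proof -
    obtain \<phi> where \<phi>: "\<phi> \<in> full_language \<Phi>" "A = holding \<Phi> \<phi>" using A by auto
    \<comment> \<open>The value of either measure is itself an admissible threshold, which yields
      both inequalities.\<close>
    have *: "\<theta> \<le> measure \<mu> A \<longleftrightarrow> \<theta> \<le> measure \<nu> A" if "\<theta> \<in> {0..1}" for \<theta>
      using assms \<phi> that unfolding represents_def by blast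
    show ?thesis
      using *[of "measure \<mu> A"] *[of "measure \<nu> A"] prob_space.prob_le_1[OF \<mu>] prob_space.prob_le_1[OF \<nu>]
      by (auto intro: antisym)
  qed
qed

lemma represents_belief_eq: "represents \<Phi> i t \<mu> \<Longrightarrow> belief (formula_space \<Phi>) i t = \<mu>"
  unfolding formula_space_def by (auto intro!: the_equality dest: represents_unique)

section \<open>Belief measures induced by the worlds of a model\<close>

lemma parts_theory_of_vimage_holding:
  assumes M: "M \<in> partition_models \<Phi>" and \<phi>: "\<phi> \<in> full_language \<Phi>"
  shows "(\<lambda>w. parts (theory_of \<Phi> {0..1} M w)) -` holding \<Phi> \<phi> \<inter> space (worlds M) = truth_set M \<phi>"
  using \<phi> sets.sets_into_space[OF truth_set_sets[OF partition_modelsD(1)[OF M] \<phi>]]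
    parts_in_formula_joint theory_of_in_world_theories[OF M]
  by (auto simp: holding_def holds_at_parts_theory_of)

lemma measurable_parts_theory_of:
  assumes M: "M \<in> partition_models \<Phi>"
  shows "(\<lambda>w. parts (theory_of \<Phi> {0..1} M w)) \<in> worlds M \<rightarrow>\<^sub>M formula_joint \<Phi>"
proof (rule measurable_sigma_sets[OF sets_formula_joint holding_subset])
  show "(\<lambda>w. parts (theory_of \<Phi> {0..1} M w)) \<in> space (worlds M) \<rightarrow> space (formula_joint \<Phi>)"
    using parts_in_formula_joint theory_of_in_world_theories[OF M] by blast
  show "(\<lambda>w. parts (theory_of \<Phi> {0..1} M w)) -` A \<inter> space (worlds M) \<in> sets (worlds M)"
    if "A \<in> holding \<Phi> ` full_language \<Phi>" for A
    using that truth_set_sets[OF partition_modelsD(1)[OF M]] parts_theory_of_vimage_holding[OF M]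
    by auto
qed

definition theory_measure ::
  "'p set \<Rightarrow> ('w, 'p, 'i::finite) model_structure \<Rightarrow> 'i \<Rightarrow> 'w \<Rightarrow>
     (('p, 'i) formula set \<times> ('i \<Rightarrow> ('p, 'i) formula set)) measure"
where
  "theory_measure \<Phi> M i w =
     distr (Pr M i w) (formula_joint \<Phi>) (\<lambda>v. parts (theory_of \<Phi> {0..1} M v))"

lemma
  assumes M: "M \<in> partition_models \<Phi>" and w: "w \<in> space (worlds M)"
  shows theory_measure_in: "theory_measure \<Phi> M i w \<in> space (prob_algebra (formula_joint \<Phi>))"
    and measure_theory_measure_holding:
      "\<phi> \<in> full_language \<Phi> \<Longrightarrow>
         measure (theory_measure \<Phi> M i w) (holding \<Phi> \<phi>) = measure (Pr M i w) (truth_set M \<phi>)"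
proof -
  note Pr = probability_frame_Pr[OF partition_modelsD(2)[OF M] w, of i]
  have meas: "(\<lambda>v. parts (theory_of \<Phi> {0..1} M v)) \<in> Pr M i w \<rightarrow>\<^sub>M formula_joint \<Phi>"
    unfolding measurable_cong_sets[OF Pr(2) refl] by (rule measurable_parts_theory_of[OF M])
  show "theory_measure \<Phi> M i w \<in> space (prob_algebra (formula_joint \<Phi>))"
    using prob_space.prob_space_distr[OF Pr(1) meas] by (simp add: theory_measure_def space_prob_algebra)
  show "measure (theory_measure \<Phi> M i w) (holding \<Phi> \<phi>) = measure (Pr M i w) (truth_set M \<phi>)"
    if "\<phi> \<in> full_language \<Phi>"
    using that
    by (simp add: theory_measure_def measure_distr[OF meas] holding_in_sets Pr(3)
        parts_theory_of_vimage_holding[OF M])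
qed

lemma represents_theory_measure:
  assumes M: "M \<in> partition_models \<Phi>" and w: "w \<in> space (worlds M)"
  shows "represents \<Phi> i (snd (parts (theory_of \<Phi> {0..1} M w)) i) (theory_measure \<Phi> M i w)"
  unfolding represents_def
  using theory_measure_in[OF M w] measure_theory_measure_holding[OF M w] w
  by (auto simp: parts_def theory_of_def)

lemmas belief_formula_space_theory_of = represents_theory_measure[THEN represents_belief_eq]

text \<open>The existence half behind the definite description in \<open>formula_space\<close>: each
  type is part of the theory of some world, and the belief at that world induces the
  measure.\<close>

lemma represents_belief_formula_space:
  assumes "t \<in> space (types (formula_space \<Phi>) i)"
  shows "represents \<Phi> i t (belief (formula_space \<Phi>) i t)"
proof -
  obtain D where D: "D \<in> world_theories \<Phi>" "t = snd (parts D) i"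
    using assms by (auto simp: formula_space_def formula_types_def)
  obtain M :: "('a, 'b) canonical_model" and w where Mw: "M \<in> partition_models \<Phi>"
    "w \<in> space (worlds M)" "D = theory_of \<Phi> {0..1} M w"
    using D(1) by (rule world_theoriesE)
  show ?thesis
    using represents_theory_measure[OF Mw(1,2), of i] belief_formula_space_theory_of[OF Mw(1,2), of i]
    by (simp add: D(2) Mw(3))
qed

section \<open>The type space of the universal model\<close>

lemma space_formula_types:
  "space (types (formula_space \<Phi>) i) = (\<lambda>D. snd (parts D) i) ` world_theories \<Phi>"
  by (simp add: formula_space_def formula_types_def)

lemma holding_vimage_types:
  assumes "\<phi> \<in> full_language \<Phi>"
  shows "{z \<in> space (formula_joint \<Phi>). \<phi> \<in> snd z i} = (if \<phi> \<in> belief_formulas i then holding \<Phi> \<phi> else {})"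
  using holds_at_belief[OF assms] by (simp add: holding_def space_formula_joint cong: conj_cong)

lemma truth_set_belief_cong:
  assumes "\<phi> \<in> belief_formulas i" "w \<in> space (worlds M)" "v \<in> space (worlds M)" "Pr M i v = Pr M i w"
  shows "v \<in> truth_set M \<phi> \<longleftrightarrow> w \<in> truth_set M \<phi>"
  using assms unfolding belief_formulas_def
  by (induction rule: boolean_combinations.induct) auto

text \<open>Introspection as a zero-one law. Truth of such a formula depends only on the measure of
  \<open>i\<close>, so if it is true at \<open>w\<close> its truth set covers all worlds sharing
  that measure; otherwise the same applies to its negation.\<close>

lemma measure_truth_set_belief_formula:
  assumes M: "probability_model \<Phi> M" and w: "w \<in> space (worlds M)"
    and \<phi>: "\<phi> \<in> belief_formulas i" "\<phi> \<in> language \<Phi> \<Theta>"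
  shows "measure (Pr M i w) (truth_set M \<phi>) = (if w \<in> truth_set M \<phi> then 1 else 0)"
proof -
  have frame: "probability_frame (worlds M) (Pr M)" using M by (simp add: probability_model_def)
  note Pr = probability_frame_Pr[OF frame w, of i]
  interpret prob_space "Pr M i w" by (rule Pr)
  have *: "prob (truth_set M \<psi>) = 1" if "w \<in> truth_set M \<psi>" "\<psi> \<in> belief_formulas i" "\<psi> \<in> language \<Phi> \<Theta>" for \<psi>
    using probability_frame_introspection[OF frame w truth_set_sets[OF M that(3)]]
      truth_set_belief_cong[OF that(2) w] that(1) by blast
  show ?thesis
  proof (cases "w \<in> truth_set M \<phi>")
    case False
    then have "prob (truth_set M (Neg \<phi>)) = 1" using \<phi> w by (intro *) auto
    then show ?thesis
      using False prob_compl[of "truth_set M \<phi>"] truth_set_sets[OF M \<phi>(2)] by (simp add: Pr)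
  qed (use * \<phi> in simp)
qed

lemma hat_subset: "hat W \<phi> \<subseteq> W"
  by (auto simp: hat_def)

lemma Int_stable_hat:
  assumes "\<And>\<phi> \<psi> D. \<phi> \<in> language \<Phi> \<Theta> \<Longrightarrow> \<psi> \<in> language \<Phi> \<Theta> \<Longrightarrow> D \<in> W \<Longrightarrow>
    Conj \<phi> \<psi> \<in> D \<longleftrightarrow> \<phi> \<in> D \<and> \<psi> \<in> D"
  shows "Int_stable (hat W ` language \<Phi> \<Theta>)"
proof (rule Int_stableI)
  fix a b assume "a \<in> hat W ` language \<Phi> \<Theta>" "b \<in> hat W ` language \<Phi> \<Theta>"
  then obtain \<phi> \<psi> where \<phi>: "\<phi> \<in> language \<Phi> \<Theta>" "a = hat W \<phi>" and \<psi>: "\<psi> \<in> language \<Phi> \<Theta>" "b = hat W \<psi>"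
    by auto
  have "a \<inter> b = hat W (Conj \<phi> \<psi>)" using assms[OF \<phi>(1) \<psi>(1)] by (auto simp: \<phi>(2) \<psi>(2) hat_def)
  then show "a \<inter> b \<in> hat W ` language \<Phi> \<Theta>" using \<phi>(1) \<psi>(1) by auto
qed

lemma Int_stable_hat_types:
  "Int_stable (hat (space (types (formula_space \<Phi>) i)) ` full_language \<Phi>)"
proof (rule Int_stable_hat)
  fix \<phi> \<psi> :: "('a, 'b) formula" and t
  assume "\<phi> \<in> full_language \<Phi>" "\<psi> \<in> full_language \<Phi>" "t \<in> space (types (formula_space \<Phi>) i)"
  then show "Conj \<phi> \<psi> \<in> t \<longleftrightarrow> \<phi> \<in> t \<and> \<psi> \<in> t"
    \<comment> \<open>A dummy profile with \<open>t\<close> in every type slot suffices, because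
      only the \<open>i\<close>-th one is inspected.\<close>
    using holds_at_belief[of _ \<Phi> "(undefined, \<lambda>_. t)" i] by (auto simp: space_formula_types)
qed

text \<open>Compare both measures on generating events. A formula about the beliefs of
  \<open>i\<close> has probability 0 or 1 by introspection at a world realising \<open>t\<close>,
  according to whether \<open>t\<close> contains it; any other formula gives the empty
  event.\<close>

lemma marginal_belief_formula_space:
  fixes \<Phi> :: "'p set" and i :: "'i::finite"
  assumes t: "t \<in> space (types (formula_space \<Phi>) i)"
  shows "distr (belief (formula_space \<Phi>) i t) (types (formula_space \<Phi>) i) (\<lambda>z. snd z i) =
    return (types (formula_space \<Phi>) i) t" (is "distr ?\<mu> ?T ?f = _")
proof (rule prob_measure_eqI_generator[OF _ _ Int_stable_hat_types])
  obtain D where D: "D \<in> world_theories \<Phi>" "t = snd (parts D) i"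
    using t by (auto simp: space_formula_types)
  obtain M :: "('p, 'i) canonical_model" and w where M: "M \<in> partition_models \<Phi>"
    and w: "w \<in> space (worlds M)" and Dw: "D = theory_of \<Phi> {0..1} M w"
    using D(1) by (rule world_theoriesE)
  have \<mu>: "?\<mu> = theory_measure \<Phi> M i w"
    using belief_formula_space_theory_of[OF M w] by (simp add: D(2) Dw)
  have \<mu>_in: "prob_space ?\<mu>" "sets ?\<mu> = sets (formula_joint \<Phi>)"
    using theory_measure_in[OF M w] by (auto simp: \<mu> space_prob_algebra)
  have space_\<mu>: "space ?\<mu> = space (formula_joint \<Phi>)" using \<mu>_in(2) by (rule sets_eq_imp_space_eq)
  have meas: "?f \<in> ?\<mu> \<rightarrow>\<^sub>M ?T"
    unfolding measurable_cong_sets[OF \<mu>_in(2) refl]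
    using measurable_type_coordinate[of i "formula_space \<Phi>"] by (simp add: joint_formula_space)
  show "prob_space (distr ?\<mu> ?T ?f)" using \<mu>_in(1) meas by (rule prob_space.prob_space_distr)
  show "prob_space (return ?T t)" using t by (rule prob_space_return)
  show "hat (space ?T) ` full_language \<Phi> \<subseteq> Pow (space ?T)" by (auto simp: hat_def)
  have sets_T: "sets ?T = sigma_sets (space ?T) (hat (space ?T) ` full_language \<Phi>)"
    unfolding space_formula_types by (simp add: formula_space_def formula_types_def sets_hat_space)
  then show "sets (distr ?\<mu> ?T ?f) = sigma_sets (space ?T) (hat (space ?T) ` full_language \<Phi>)"
    "sets (return ?T t) = sigma_sets (space ?T) (hat (space ?T) ` full_language \<Phi>)"
    by simp_all
  show "measure (distr ?\<mu> ?T ?f) A = measure (return ?T t) A"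
    if A: "A \<in> hat (space ?T) ` full_language \<Phi>" for A
  proof -
    obtain \<phi> where \<phi>: "\<phi> \<in> full_language \<Phi>" "A = hat (space ?T) \<phi>" using A by auto
    have A_sets: "A \<in> sets ?T" using A by (auto simp: sets_T)
    have "?f -` A \<inter> space ?\<mu> = {z \<in> space (formula_joint \<Phi>). \<phi> \<in> snd z i}"
      by (auto simp: space_\<mu> \<phi>(2) hat_def space_formula_types space_formula_joint)
    then have "measure (distr ?\<mu> ?T ?f) A = measure ?\<mu> {z \<in> space (formula_joint \<Phi>). \<phi> \<in> snd z i}"
      using measure_distr[OF meas A_sets] by simp
    also have "\<dots> = (if \<phi> \<in> belief_formulas i \<and> w \<in> truth_set M \<phi> then 1 else 0)"
      using measure_theory_measure_holding[OF M w \<phi>(1), of i]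
        measure_truth_set_belief_formula[OF partition_modelsD(1)[OF M] w _ \<phi>(1), of i]
      by (simp add: holding_vimage_types[OF \<phi>(1)] \<mu>)
    also have "\<dots> = indicator A t"
      using t \<phi> by (auto simp: hat_def D(2) Dw parts_def theory_of_def split: split_indicator)
    also have "\<dots> = measure (return ?T t) A"
      using A_sets by (simp add: measure_return)
    finally show ?thesis .
  qed
qed

lemma measurable_belief_formula_space:
  fixes \<Phi> :: "'p set" and i :: "'i::finite"
  shows "belief (formula_space \<Phi>) i \<in> types (formula_space \<Phi>) i \<rightarrow>\<^sub>M prob_algebra (formula_joint \<Phi>)"
    (is "?b \<in> ?T \<rightarrow>\<^sub>M _")
proof (rule measurable_prob_algebra_generated[OF sets_formula_joint Int_stable_holding holding_subset])
  have rep: "represents \<Phi> i t (?b t)" if "t \<in> space ?T" for t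
    using that by (rule represents_belief_formula_space)
  show prob: "prob_space (?b t)" and "sets (?b t) = sets (formula_joint \<Phi>)" if "t \<in> space ?T" for t
    using rep[OF that] by (auto simp: represents_def space_prob_algebra)
  show "(\<lambda>t. emeasure (?b t) A) \<in> borel_measurable ?T"
    if A: "A \<in> holding \<Phi> ` full_language \<Phi>" for A
  proof -
    obtain \<phi> where \<phi>: "\<phi> \<in> full_language \<Phi>" "A = holding \<Phi> \<phi>" using A by auto
    have "(\<lambda>t. measure (?b t) A) \<in> borel_measurable ?T"
      unfolding borel_measurable_iff_ge
    proof
      fix \<theta> :: real
      \<comment> \<open>Inside the unit interval the superlevel set is the generating event of one
        belief formula. Other thresholds do not occur in the language and give the whole space or
        the empty set.\<close>
      consider "\<theta> < 0" | "\<theta> \<in> {0..1}" | "\<theta> > 1" by fastforce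
      then show "{t \<in> space ?T. \<theta> \<le> measure (?b t) A} \<in> sets ?T"
      proof cases
        case 1
        then have "{t \<in> space ?T. \<theta> \<le> measure (?b t) A} = space ?T"
          by (auto intro: order_trans[OF less_imp_le measure_nonneg])
        then show ?thesis by simp
      next
        case 2
        have "{t \<in> space ?T. \<theta> \<le> measure (?b t) A} = hat (space ?T) (Bel i \<theta> \<phi>)"
          using rep 2 \<phi> by (auto simp: hat_def represents_def)
        moreover have "hat (space ?T) (Bel i \<theta> \<phi>) \<in> sets ?T"
          unfolding space_formula_types using 2 \<phi>
          by (simp add: formula_space_def formula_types_def hat_in_sets)
        ultimately show ?thesis by (simp only:)
      next
        case 3
        have "measure (?b t) A < \<theta>" if "t \<in> space ?T" for t
          using prob_space.prob_le_1[OF prob[OF that], of A] 3 by simp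
        then have "{t \<in> space ?T. \<theta> \<le> measure (?b t) A} = {}" by force
        then show ?thesis by (simp only: sets.empty_sets)
      qed
    qed
    then have "(\<lambda>t. ennreal (measure (?b t) A)) \<in> borel_measurable ?T" by measurable
    moreover have "emeasure (?b t) A = ennreal (measure (?b t) A)" if "t \<in> space ?T" for t
      using prob_space.finite_measure[OF prob[OF that]] by (rule finite_measure.emeasure_eq_measure)
    ultimately show ?thesis by (subst measurable_cong) auto
  qed
qed

lemma type_space_formula_space: "type_space (formula_space \<Phi>)"
  by (simp add: type_space_def joint_formula_space measurable_belief_formula_space
      marginal_belief_formula_space)

text \<open>The interpretation is a parameter because the construction serves twice: with
  descriptions as states, where \<open>p\<close> holds if \<open>Prop p\<close> belongs to the
  state, and over \<open>X\<close>, where \<open>p\<close> holds exactly at the state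
  \<open>p\<close>.\<close>

definition type_space_model ::
  "('p \<Rightarrow> 'x set) \<Rightarrow> ('x, 'i, 't) type_structure \<Rightarrow> ('x \<times> ('i \<Rightarrow> 't), 'p, 'i) model_structure"
where
  "type_space_model A T =
     \<lparr> worlds = joint T, Pr = (\<lambda>i z. belief T i (snd z i)),
       interp = (\<lambda>p. {z \<in> space (joint T). fst z \<in> A p}) \<rparr>"

lemma type_space_model_simps [simp]:
  "worlds (type_space_model A T) = joint T"
  "Pr (type_space_model A T) i z = belief T i (snd z i)"
  "interp (type_space_model A T) p = {z \<in> space (joint T). fst z \<in> A p}"
  by (simp_all add: type_space_model_def)

lemma probability_model_type_space_model:
  fixes T :: "('x, 'i::finite, 't) type_structure"
  assumes "type_space T" "\<And>p. p \<in> \<Phi> \<Longrightarrow> {z \<in> space (joint T). fst z \<in> A p} \<in> sets (joint T)"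
  shows "probability_model \<Phi> (type_space_model A T)"
  using assms type_space_probability_frame[OF assms(1)]
  by (simp add: probability_model_def type_space_model_def)

abbreviation (input) formula_model ::
  "'p set \<Rightarrow> (('p, 'i::finite) formula set \<times> ('i \<Rightarrow> ('p, 'i) formula set), 'p, 'i) model_structure"
where
  "formula_model \<Phi> \<equiv> type_space_model (\<lambda>p. {d. Prop p \<in> d}) (formula_space \<Phi>)"

lemma probability_model_formula_model: "probability_model \<Phi> (formula_model \<Phi>)"
proof (rule probability_model_type_space_model[OF type_space_formula_space])
  fix p assume "p \<in> \<Phi>"
  then show "{z \<in> space (joint (formula_space \<Phi>)). fst z \<in> {d. Prop p \<in> d}} \<in> sets (joint (formula_space \<Phi>))"
    using holding_in_sets[of "Prop p" \<Phi>] by (simp add: holding_def joint_formula_space)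
qed

text \<open>The truth lemma: the belief at a type meets exactly the thresholds that the type
  asserts, so syntactic \<open>holds_at\<close> becomes truth in a model and every profile becomes
  satisfiable.\<close>

lemma truth_set_formula_model:
  "\<phi> \<in> full_language \<Phi> \<Longrightarrow> truth_set (formula_model \<Phi>) \<phi> = holding \<Phi> \<phi>"
proof (induction rule: language.induct)
  case (4 \<phi> \<theta> i)
  have "represents \<Phi> i (snd z i) (belief (formula_space \<Phi>) i (snd z i))"
    if "z \<in> space (formula_joint \<Phi>)" for z
    using that by (intro represents_belief_formula_space) (simp add: space_formula_types space_formula_joint)
  then show ?case
    using 4 by (auto simp: holding_def[of _ "Bel i \<theta> \<phi>"] joint_formula_space represents_def)
qed (auto simp: holding_def joint_formula_space)

lemma joint_description_eq:
  fixes z :: "('p, 'i::finite) formula set \<times> ('i \<Rightarrow> ('p, 'i) formula set)"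
  assumes z: "z \<in> space (formula_joint \<Phi>)"
  shows "joint_description \<Phi> {0..1} z = {\<phi> \<in> full_language \<Phi>. holds_at z \<phi>}"
  unfolding joint_description_def
proof (rule the_equality)
  have fst_z: "fst z \<in> (\<lambda>D. fst (parts D)) ` world_theories \<Phi>"
    and snd_z: "snd z i \<in> (\<lambda>D. snd (parts D) i) ` world_theories \<Phi>" for i
    using z by (auto simp: space_formula_joint)
  \<comment> \<open>Existence: a description has to be satisfiable in some probability model, and
    \<open>formula_model\<close> satisfies this one at the world \<open>z\<close>.\<close>
  have "theory_of \<Phi> {0..1} (formula_model \<Phi>) z = {\<phi> \<in> full_language \<Phi>. holds_at z \<phi>}"
    using z by (auto simp: theory_of_def truth_set_formula_model holding_def)
  moreover have "description \<Phi> {0..1} (theory_of \<Phi> {0..1} (formula_model \<Phi>) z)"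
    using z by (intro description_theory_of[OF probability_model_formula_model]) (simp add: joint_formula_space)
  moreover have "D \<subseteq> full_language \<Phi>" if "D \<in> world_theories \<Phi>" for D :: "('p, 'i) formula set"
    using that by (auto simp: universal_worlds_def description_def)
  then have "fst z \<subseteq> full_language \<Phi>" "snd z i \<subseteq> full_language \<Phi>" for i
    using fst_z snd_z by (fastforce simp: parts_def)+
  then have "fst z \<subseteq> {\<phi> \<in> full_language \<Phi>. holds_at z \<phi>}"
    "snd z i \<subseteq> {\<phi> \<in> full_language \<Phi>. holds_at z \<phi>}" for i
    using holds_at_prop[OF _ fst_z] holds_at_belief[OF _ snd_z] by blast+
  ultimately show "description \<Phi> {0..1} {\<phi> \<in> full_language \<Phi>. holds_at z \<phi>} \<and>
      fst z \<union> (\<Union>i. snd z i) \<subseteq> {\<phi> \<in> full_language \<Phi>. holds_at z \<phi>}"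
    by (simp add: UN_subset_iff)
next
  fix D assume D: "description \<Phi> {0..1} D \<and> fst z \<union> (\<Union>i. snd z i) \<subseteq> D"
  then obtain M :: "('p, 'i) canonical_model" and w where
    w: "w \<in> space (worlds M)" "\<forall>\<phi> \<in> D. w \<in> truth_set M \<phi>"
    by (auto simp: description_def satisfiable_def satisfiable_in_def)
  have D_eq: "D = theory_of \<Phi> {0..1} M w" using D w by (intro description_eq_theory_of) auto
  \<comment> \<open>Uniqueness: for each primitive proposition and each belief formula, it or its
    negation lies in a component of \<open>z\<close>, hence in \<open>D\<close>. Boolean structure
    settles the rest.\<close>
  have "w \<in> truth_set M \<phi> \<longleftrightarrow> holds_at z \<phi>" if "\<phi> \<in> full_language \<Phi>" for \<phi>
    using that
  proof (induction rule: language.induct)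
    case (1 p)
    then have "Prop p \<in> fst z \<longleftrightarrow> holds_at z (Prop p)" "Neg (Prop p) \<in> fst z \<longleftrightarrow> \<not> holds_at z (Prop p)"
      using z holds_at_prop[of "Neg (Prop p)" \<Phi> z] by (simp_all add: space_formula_joint)
    then show ?case using w(2) D by (cases "holds_at z (Prop p)") force+
  next
    case (4 \<phi> \<theta> i)
    then have "Bel i \<theta> \<phi> \<in> snd z i \<longleftrightarrow> holds_at z (Bel i \<theta> \<phi>)"
      "Neg (Bel i \<theta> \<phi>) \<in> snd z i \<longleftrightarrow> \<not> holds_at z (Bel i \<theta> \<phi>)"
      using z holds_at_belief[of "Neg (Bel i \<theta> \<phi>)" \<Phi> z i] by (simp_all add: space_formula_joint)
    moreover have "w \<in> truth_set M \<psi>" if "\<psi> \<in> snd z i" for \<psi>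
      using that w(2) D by blast
    ultimately show ?case
      by (cases "holds_at z (Bel i \<theta> \<phi>)") (force simp del: holds_at.simps truth_set.simps(4))+
  qed (use w(1) in auto)
  then show "D = {\<phi> \<in> full_language \<Phi>. holds_at z \<phi>}"
    unfolding D_eq by (auto simp: theory_of_def)
qed

section \<open>Beliefs and truth in the universal model\<close>

abbreviation (input) universal_partition_model :: "'p set \<Rightarrow> ('p, 'i::finite) canonical_model" where
  "universal_partition_model \<Phi> \<equiv> universal_model \<Phi> (partition_models \<Phi>)"

lemma Int_stable_hat_theories: "Int_stable (hat (world_theories \<Phi>) ` full_language \<Phi>)"
proof (rule Int_stable_hat)
  fix D :: "('a, 'b) formula set"
  show "Conj \<phi> \<psi> \<in> D \<longleftrightarrow> \<phi> \<in> D \<and> \<psi> \<in> D"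
    if "\<phi> \<in> full_language \<Phi>" "\<psi> \<in> full_language \<Phi>" "D \<in> world_theories \<Phi>" for \<phi> \<psi>
    using that holds_at_parts[of D \<Phi> "Conj \<phi> \<psi>"] by (simp add: holds_at_parts)
qed

text \<open>Evaluates the definite description in \<open>universal_model\<close>: at the theory of
  \<open>w\<close> it denotes the image of \<open>Pr M i w\<close> under the theory map, whichever
  \<open>M\<close> and \<open>w\<close> realise that theory.\<close>

lemma measure_Pr_universal_model:
  fixes M :: "('p, 'i::finite) canonical_model"
  assumes M: "M \<in> partition_models \<Phi>" and w: "w \<in> space (worlds M)" and \<phi>: "\<phi> \<in> full_language \<Phi>"
  shows "measure (Pr (universal_partition_model \<Phi>) i (theory_of \<Phi> {0..1} M w))
      (hat (world_theories \<Phi>) \<phi>) = measure (Pr M i w) (truth_set M \<phi>)"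
proof -
  let ?W = "world_theories \<Phi> :: ('p, 'i) formula set set"
  let ?D = "theory_of \<Phi> {0..1} M"
  let ?Q = "hat_space \<Phi> {0..1} ?W"
  note model = partition_modelsD(1)[OF M]
  note Pr = probability_frame_Pr[OF partition_modelsD(2)[OF M] w, of i]
  interpret prob_space "Pr M i w" by (rule Pr)
  have vimage_hat: "?D -` hat ?W \<psi> \<inter> space (worlds M) = truth_set M \<psi>" if "\<psi> \<in> full_language \<Phi>" for \<psi>
    using that sets.sets_into_space[OF truth_set_sets[OF model that]] theory_of_in_world_theories[OF M]
    by (auto simp: hat_def theory_of_def)
  have "?D \<in> worlds M \<rightarrow>\<^sub>M ?Q"
  proof (rule measurable_into_hat_space)
    fix \<psi> :: "('p, 'i) formula" assume \<psi>: "\<psi> \<in> full_language \<Phi>"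
    have "{v \<in> space (worlds M). \<psi> \<in> ?D v} = truth_set M \<psi>"
      using \<psi> sets.sets_into_space[OF truth_set_sets[OF model \<psi>]] by (auto simp: theory_of_def)
    then show "{v \<in> space (worlds M). \<psi> \<in> ?D v} \<in> sets (worlds M)"
      using truth_set_sets[OF model \<psi>] by simp
  qed (rule theory_of_in_world_theories[OF M])
  then have meas: "?D \<in> Pr M i w \<rightarrow>\<^sub>M ?Q"
    unfolding measurable_cong_sets[OF Pr(2) refl] .
  let ?\<nu> = "distr (Pr M i w) ?Q ?D"
  have \<nu>_hat: "measure ?\<nu> (hat ?W \<psi>) = prob (truth_set M \<psi>)" if "\<psi> \<in> full_language \<Phi>" for \<psi>
    using that by (simp add: measure_distr[OF meas] hat_in_sets Pr vimage_hat)
  \<comment> \<open>The supremum is attained at the probability itself, which is one of the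
    thresholds.\<close>
  have Sup: "Sup {\<theta> \<in> {0..1}. Bel i \<theta> \<psi> \<in> ?D w} = prob (truth_set M \<psi>)"
    if "\<psi> \<in> full_language \<Phi>" for \<psi>
    by (rule cSup_eq_maximum) (use w that in \<open>auto simp: theory_of_def\<close>)
  have "Pr (universal_partition_model \<Phi>) i (?D w) = ?\<nu>"
    unfolding universal_model_def Let_def model_structure.simps
  proof (rule the_equality)
    show "?\<nu> \<in> space (prob_algebra ?Q) \<and> (\<forall>\<psi> \<in> full_language \<Phi>.
        measure ?\<nu> (hat ?W \<psi>) = Sup {\<theta> \<in> {0..1}. Bel i \<theta> \<psi> \<in> ?D w})"
      using prob_space_distr[OF meas]
      by (simp add: space_prob_algebra \<nu>_hat Sup del: atLeastAtMost_iff)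
    fix \<mu> assume \<mu>: "\<mu> \<in> space (prob_algebra ?Q) \<and> (\<forall>\<psi> \<in> full_language \<Phi>.
        measure \<mu> (hat ?W \<psi>) = Sup {\<theta> \<in> {0..1}. Bel i \<theta> \<psi> \<in> ?D w})"
    show "\<mu> = ?\<nu>"
      by (rule prob_measure_eqI_generator[OF _ _ Int_stable_hat_theories])
         (use \<mu> prob_space_distr[OF meas] in
            \<open>auto simp: space_prob_algebra sets_hat_space \<nu>_hat Sup dest: set_mp[OF hat_subset]
              simp del: atLeastAtMost_iff\<close>)
  qed
  then show ?thesis using \<nu>_hat[OF \<phi>] by simp
qed

lemma space_worlds_universal_model: "space (worlds (universal_model \<Phi> C)) = universal_worlds \<Phi> C"
  by (simp add: universal_model_def Let_def)

lemma truth_set_universal_model: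
  fixes \<phi> :: "('p, 'i::finite) formula"
  shows "\<phi> \<in> full_language \<Phi> \<Longrightarrow>
    truth_set (universal_partition_model \<Phi>) \<phi> = hat (world_theories \<Phi>) \<phi>"
proof (induction rule: language.induct)
  case (1 p)
  then show ?case by (simp add: universal_model_def Let_def)
next
  case (2 \<phi>)
  then have "Neg \<phi> \<in> D \<longleftrightarrow> \<phi> \<notin> D" if "D \<in> world_theories \<Phi>" for D
    using that holds_at_parts[OF that, of \<phi>] holds_at_parts[OF that, of "Neg \<phi>"] by simp
  then show ?case using 2 by (auto simp: space_worlds_universal_model hat_def)
next
  case (3 \<phi> \<psi>)
  then have "Conj \<phi> \<psi> \<in> D \<longleftrightarrow> \<phi> \<in> D \<and> \<psi> \<in> D" if "D \<in> world_theories \<Phi>" for D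
    using that holds_at_parts[OF that, of \<phi>] holds_at_parts[OF that, of \<psi>]
      holds_at_parts[OF that, of "Conj \<phi> \<psi>"] by simp
  then show ?case using 3 by (auto simp: hat_def)
next
  case (4 \<phi> \<theta> i)
  have "\<theta> \<le> measure (Pr (universal_partition_model \<Phi>) i D) (hat (world_theories \<Phi>) \<phi>) \<longleftrightarrow> Bel i \<theta> \<phi> \<in> D"
    if D: "D \<in> world_theories \<Phi>" for D
  proof -
    obtain M :: "('p, 'i) canonical_model" and w where M: "M \<in> partition_models \<Phi>"
      and w: "w \<in> space (worlds M)" and Dw: "D = theory_of \<Phi> {0..1} M w"
      using D by (rule world_theoriesE)
    show ?thesis
      unfolding Dw measure_Pr_universal_model[OF M w 4(1)] using 4 w by (simp add: theory_of_def)
  qed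
  then show ?case using 4 by (auto simp: space_worlds_universal_model hat_def)
qed

lemma theory_of_universal_model:
  assumes "D \<in> world_theories \<Phi>"
  shows "theory_of \<Phi> {0..1} (universal_partition_model \<Phi>) D = D"
proof -
  have "D \<subseteq> full_language \<Phi>" using assms by (auto simp: universal_worlds_def description_def)
  then show ?thesis
    using assms by (auto simp: theory_of_def truth_set_universal_model hat_def)
qed

text \<open>Each world of the universal model is its own theory, so the carriers agree;
  \<open>joint_description_eq\<close> then makes the two definite descriptions of the beliefs
  literally the same.\<close>

lemma type_space_of_universal_model:
  "type_space_of \<Phi> {0..1} (universal_partition_model \<Phi>) = formula_space \<Phi>"
proof -
  let ?M = "universal_partition_model \<Phi>"
  have states: "state_part \<Phi> {0..1} ?M ` space (worlds ?M) = (\<lambda>D. fst (parts D)) ` world_theories \<Phi>"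
    by (intro image_cong) (simp_all add: space_worlds_universal_model state_part_def parts_def
        theory_of_universal_model prop_formulas_def)
  have types: "type_part \<Phi> {0..1} ?M i ` space (worlds ?M) = (\<lambda>D. snd (parts D) i) ` world_theories \<Phi>" for i
    by (intro image_cong) (simp_all add: space_worlds_universal_model type_part_def parts_def
        theory_of_universal_model belief_formulas_def)
  have holding: "{z \<in> space (formula_joint \<Phi>). \<phi> \<in> joint_description \<Phi> {0..1} z} = holding \<Phi> \<phi>"
    if "\<phi> \<in> full_language \<Phi>" for \<phi> :: "('a, 'b) formula"
    using that by (auto simp: joint_description_eq holding_def)
  show ?thesis
    unfolding type_space_of_def Let_def states types
    unfolding formula_states_def[symmetric] formula_types_def[symmetric] formula_joint_def[symmetric]
    by (simp add: formula_space_def represents_def holding cong: ball_cong)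
qed

section \<open>States\<close>

lemma world_theories_unique_state:
  assumes "D \<in> world_theories \<Phi>"
  shows "\<exists>!p. p \<in> \<Phi> \<and> Prop p \<in> D"
proof -
  obtain M :: "('a, 'b) canonical_model" and w where M: "M \<in> partition_models \<Phi>"
    and w: "w \<in> space (worlds M)" and D: "D = theory_of \<Phi> {0..1} M w"
    using assms by (rule world_theoriesE)
  have part: "partition_on (space (worlds M)) (interp M ` \<Phi>)" and inj: "inj_on (interp M) \<Phi>"
    using M by (auto simp: partition_models_def)
  obtain p where p: "p \<in> \<Phi>" "w \<in> interp M p"
    using partition_onD1[OF part] w by blast
  have "q = p" if "q \<in> \<Phi>" "w \<in> interp M q" for q
  proof -
    have "interp M q = interp M p"
      using disjointD[OF partition_onD2[OF part], of "interp M q" "interp M p"] that p by auto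
    then show ?thesis using inj that(1) p(1) by (simp add: inj_on_eq_iff)
  qed
  moreover have "Prop q \<in> D \<longleftrightarrow> w \<in> interp M q" if "q \<in> \<Phi>" for q
    using that by (simp add: D theory_of_def)
  ultimately show ?thesis using p by blast
qed

lemma state_of_eq:
  assumes "D \<in> world_theories \<Phi>" "p \<in> \<Phi>" "Prop p \<in> D"
  shows "state_of \<Phi> (fst (parts D)) = p"
  using world_theories_unique_state[OF assms(1)] assms(2,3)
  by (auto simp: state_of_def parts_def)

lemma state_of_mem:
  assumes "D \<in> world_theories \<Phi>"
  shows "state_of \<Phi> (fst (parts D)) \<in> \<Phi>"
    "p \<in> \<Phi> \<Longrightarrow> Prop p \<in> fst (parts D) \<longleftrightarrow> state_of \<Phi> (fst (parts D)) = p"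
proof -
  obtain q where q: "q \<in> \<Phi>" "Prop q \<in> D" "\<And>r. r \<in> \<Phi> \<Longrightarrow> Prop r \<in> D \<Longrightarrow> r = q"
    using world_theories_unique_state[OF assms] by blast
  then have "state_of \<Phi> (fst (parts D)) = q" using assms by (intro state_of_eq)
  moreover have "Prop p \<in> fst (parts D) \<longleftrightarrow> Prop p \<in> D" by (simp add: parts_def)
  ultimately show "state_of \<Phi> (fst (parts D)) \<in> \<Phi>"
    "p \<in> \<Phi> \<Longrightarrow> Prop p \<in> fst (parts D) \<longleftrightarrow> state_of \<Phi> (fst (parts D)) = p"
    using q by blast+
qed

text \<open>Gives surjectivity of \<open>state_of\<close>. The witness has one world per state and
  lets every agent be certain of the actual world; on a discrete space no measurability question
  arises.\<close>

lemma world_theories_state_exists: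
  fixes p :: 'p
  assumes p: "p \<in> \<Phi>"
  shows "\<exists>D :: ('p, 'i::finite) formula set. D \<in> world_theories \<Phi> \<and> Prop p \<in> D"
proof -
  define M :: "('p, 'p, 'i) model_structure" where
    "M = \<lparr> worlds = count_space \<Phi>, Pr = (\<lambda>i. return (count_space \<Phi>)), interp = (\<lambda>p. {p}) \<rparr>"
  have "outer_measure_of (return (count_space \<Phi>) w)
      (return (count_space \<Phi>) -` {return (count_space \<Phi>) w} \<inter> \<Phi>) = 1" if "w \<in> \<Phi>" for w
    using that by (intro outer_measure_of_eq_1I prob_space_return) (auto simp: measure_return)
  then have "probability_model \<Phi> M"
    by (auto simp: probability_model_def probability_frame_def M_def space_prob_algebra
        intro!: prob_space_return)
  then have "M \<in> partition_models \<Phi>"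
    by (auto simp: partition_models_def M_def partition_on_def disjoint_def)
  then have "theory_of \<Phi> {0..1} M p \<in> world_theories \<Phi>"
    using p by (intro theory_of_in_world_theories) (auto simp: M_def)
  moreover have "Prop p \<in> theory_of \<Phi> {0..1} M p"
    using p by (simp add: theory_of_def M_def)
  ultimately show ?thesis by blast
qed

text \<open>A propositional description is determined by the primitive propositions in it, and the
  only one from \<open>\<Phi>\<close> is its state.\<close>

lemma inj_on_state_of: "inj_on (state_of \<Phi>) (space (formula_states \<Phi>))"
proof (rule inj_onI)
  fix s s' :: "('a, 'b) formula set"
  assume "s \<in> space (formula_states \<Phi>)" "s' \<in> space (formula_states \<Phi>)"
    and eq: "state_of \<Phi> s = state_of \<Phi> s'"
  then have s: "s \<in> (\<lambda>D. fst (parts D)) ` world_theories \<Phi>" "s' \<in> (\<lambda>D. fst (parts D)) ` world_theories \<Phi>"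
    by (simp_all add: formula_states_def)
  have Prop_iff: "Prop p \<in> s \<longleftrightarrow> Prop p \<in> s'" if "p \<in> \<Phi>" for p
  proof -
    obtain D D' where "D \<in> world_theories \<Phi>" "D' \<in> world_theories \<Phi>" "s = fst (parts D)" "s' = fst (parts D')"
      using s by blast
    then show ?thesis using eq that by (simp add: state_of_mem(2))
  qed
  have "holds_at (s, t) \<phi> \<longleftrightarrow> holds_at (s', t) \<phi>"
    if "\<phi> \<in> full_language \<Phi>" "\<phi> \<in> prop_formulas" for \<phi> t
    using that by (induction rule: language.induct) (auto simp: Prop_iff)
  then have "\<phi> \<in> s \<longleftrightarrow> \<phi> \<in> s'" if "\<phi> \<in> full_language \<Phi>" for \<phi>
    using that s holds_at_prop[of \<phi> \<Phi> "(s, undefined)"] holds_at_prop[of \<phi> \<Phi> "(s', undefined)"] by auto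
  moreover have "s \<subseteq> full_language \<Phi>" "s' \<subseteq> full_language \<Phi>"
    using s by (auto simp: parts_def universal_worlds_def description_def)
  ultimately show "s = s'" by blast
qed

lemma bij_betw_state_of:
  fixes \<Phi> :: "'p set"
  shows "bij_betw (state_of \<Phi>) (space (formula_states \<Phi> :: ('p, 'i::finite) formula set measure)) \<Phi>"
proof (rule bij_betw_imageI[OF inj_on_state_of])
  let ?S = "space (formula_states \<Phi> :: ('p, 'i) formula set measure)"
  have "p \<in> state_of \<Phi> ` ?S" if p: "p \<in> \<Phi>" for p
  proof -
    obtain D :: "('p, 'i) formula set" where D: "D \<in> world_theories \<Phi>" "Prop p \<in> D"
      using world_theories_state_exists[OF p] by blast
    then have "fst (parts D) \<in> ?S" by (simp add: formula_states_def)
    then show ?thesis using state_of_eq[OF D(1) p D(2)] by (intro image_eqI) (rule sym)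
  qed
  moreover have "state_of \<Phi> s \<in> \<Phi>" if "s \<in> ?S" for s
    using that by (auto simp: formula_states_def state_of_mem(1))
  ultimately show "state_of \<Phi> ` ?S = \<Phi>" by blast
qed

definition state_description :: "'p set \<Rightarrow> 'p \<Rightarrow> ('p, 'i::finite) formula set" where
  "state_description \<Phi> = the_inv_into (space (formula_states \<Phi>)) (state_of \<Phi>)"

lemma state_description:
  fixes \<Phi> :: "'p set"
  shows "p \<in> \<Phi> \<Longrightarrow> (state_description \<Phi> p :: ('p, 'i::finite) formula set) \<in> space (formula_states \<Phi>)"
    and "p \<in> \<Phi> \<Longrightarrow> state_of \<Phi> (state_description \<Phi> p :: ('p, 'i) formula set) = p"
    and "s \<in> space (formula_states \<Phi>) \<Longrightarrow> state_description \<Phi> (state_of \<Phi> s) = (s :: ('p, 'i) formula set)"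
proof -
  note bij = bij_betw_state_of[of \<Phi>, where 'i = 'i]
  show "p \<in> \<Phi> \<Longrightarrow> (state_description \<Phi> p :: ('p, 'i::finite) formula set) \<in> space (formula_states \<Phi>)"
    unfolding state_description_def using bij
    by (metis bij_betw_def order_refl the_inv_into_into)
  show "p \<in> \<Phi> \<Longrightarrow> state_of \<Phi> (state_description \<Phi> p :: ('p, 'i) formula set) = p"
    unfolding state_description_def using bij by (rule f_the_inv_into_f_bij_betw) simp
  show "s \<in> space (formula_states \<Phi>) \<Longrightarrow> state_description \<Phi> (state_of \<Phi> s) = s"
    unfolding state_description_def using inj_on_state_of by (rule the_inv_into_f_f)
qed

lemma Prop_in_state_description:
  fixes \<Phi> :: "'p set"
  assumes "p \<in> \<Phi>" "q \<in> \<Phi>"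
  shows "Prop q \<in> (state_description \<Phi> p :: ('p, 'i::finite) formula set) \<longleftrightarrow> q = p"
proof -
  let ?k = "state_description \<Phi> p :: ('p, 'i) formula set"
  obtain D :: "('p, 'i) formula set" where "D \<in> world_theories \<Phi>" "?k = fst (parts D)"
    using state_description(1)[OF assms(1)] by (auto simp: formula_states_def)
  then have "Prop q \<in> ?k \<longleftrightarrow> state_of \<Phi> ?k = q"
    using state_of_mem(2)[OF _ assms(2)] by simp
  then show ?thesis unfolding state_description(2)[OF assms(1)] by (simp only: eq_commute)
qed

text \<open>Generation by singletons enters here: the preimage of a singleton is the generating
  event of one primitive proposition. For the inverse, \<open>measurable_state_description\<close>,
  singletons have to be events.\<close>

lemma measurable_state_of:
  fixes X :: "'x measure"
  assumes X: "sets X = sigma_sets (space X) {{x} | x. x \<in> space X}"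
  shows "state_of (space X) \<in> (formula_states (space X) :: ('x, 'i::finite) formula set measure) \<rightarrow>\<^sub>M X"
    (is "_ \<in> ?S \<rightarrow>\<^sub>M _")
proof (rule measurable_sigma_sets[OF X])
  show "state_of (space X) \<in> space ?S \<rightarrow> space X"
    using bij_betw_state_of[of "space X", where 'i = 'i] by (auto simp: bij_betw_def)
  fix A assume "A \<in> {{x} | x. x \<in> space X}"
  then obtain x where x: "x \<in> space X" "A = {x}" by auto
  have "state_of (space X) -` A \<inter> space ?S =
      hat (space ?S) (Prop x)"
    using x state_of_mem(2)[OF _ x(1)] by (auto simp: hat_def formula_states_def)
  moreover have "hat (space ?S) (Prop x) \<in> sets ?S"
    using x hat_in_sets[of "Prop x"] by (simp add: formula_states_def)
  ultimately show "state_of (space X) -` A \<inter> space ?S \<in> sets ?S"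
    by (simp only:)
qed auto

lemma measurable_state_description:
  fixes X :: "'x measure"
  assumes X: "\<And>x. x \<in> space X \<Longrightarrow> {x} \<in> sets X"
  shows "(state_description (space X) :: 'x \<Rightarrow> ('x, 'i::finite) formula set)
    \<in> X \<rightarrow>\<^sub>M formula_states (space X)"
  unfolding formula_states_def
proof (rule measurable_into_hat_space)
  let ?k = "state_description (space X) :: 'x \<Rightarrow> ('x, 'i) formula set"
  show k: "?k x \<in> (\<lambda>D. fst (parts D)) ` world_theories (space X)" if "x \<in> space X" for x
    using state_description(1)[OF that] by (simp add: formula_states_def)
  fix \<phi> :: "('x, 'i) formula" assume \<phi>: "\<phi> \<in> full_language (space X)"
  \<comment> \<open>The induction runs over \<open>holds_at\<close>, which is recursive, rather than
    over membership in \<open>?k x\<close>; propositional formulas do not look at the second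
    component.\<close>
  have "\<phi> \<in> prop_formulas \<Longrightarrow> {x \<in> space X. holds_at (?k x, undefined) \<phi>} \<in> sets X"
    using \<phi>
  proof (induction rule: language.induct)
    case (1 p)
    have "{x \<in> space X. holds_at (?k x, undefined) (Prop p)} = {p}"
      using 1 by (auto simp: Prop_in_state_description)
    then show ?case using X 1 by simp
  next
    case (2 \<phi>)
    then show ?case by auto
  next
    case (3 \<phi> \<psi>)
    have "{x \<in> space X. holds_at (?k x, undefined) (Conj \<phi> \<psi>)} =
        {x \<in> space X. holds_at (?k x, undefined) \<phi>} \<inter> {x \<in> space X. holds_at (?k x, undefined) \<psi>}" by auto
    then show ?case using 3 by auto
  qed simp
  moreover have "{x \<in> space X. \<phi> \<in> ?k x} =
      (if \<phi> \<in> prop_formulas then {x \<in> space X. holds_at (?k x, undefined) \<phi>} else {})"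
    using k holds_at_prop[OF \<phi>] by auto
  ultimately show "{x \<in> space X. \<phi> \<in> ?k x} \<in> sets X" by simp
qed

lemma singletons_in_sets:
  assumes "sets X = sigma_sets (space X) {{x} | x. x \<in> space X}" "x \<in> space X"
  shows "{x} \<in> sets X"
  unfolding assms(1) using assms(2) by auto

text \<open>Images under a bijection are preimages under its inverse, so measurability in both
  directions gives the two inclusions. Hence the transported sigma-algebra of
  \<open>identify_states\<close> is that of \<open>X\<close>.\<close>

lemma image_state_of_sets:
  fixes X :: "'x measure"
  assumes X: "sets X = sigma_sets (space X) {{x} | x. x \<in> space X}"
  shows "(`) (state_of (space X)) ` sets (formula_states (space X) :: ('x, 'i::finite) formula set measure) = sets X"
proof -
  let ?S = "formula_states (space X) :: ('x, 'i) formula set measure"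
  let ?h = "state_of (space X)"
  note k = state_description[where \<Phi> = "space X" and 'i = 'i]
  have h: "?h s \<in> space X" if "s \<in> space ?S" for s
    using measurable_space[OF measurable_state_of[OF X] that] .
  show ?thesis
  proof (intro set_eqI iffI)
    fix B assume "B \<in> (`) ?h ` sets ?S"
    then obtain A where A: "A \<in> sets ?S" "B = ?h ` A" by auto
    have "B = state_description (space X) -` A \<inter> space X"
    proof (intro set_eqI iffI)
      show "x \<in> state_description (space X) -` A \<inter> space X" if "x \<in> B" for x
        using that A sets.sets_into_space[OF A(1)] h k(3) by auto
      show "x \<in> B" if "x \<in> state_description (space X) -` A \<inter> space X" for x
        using that A(2) k(2) by (metis IntD1 IntD2 image_eqI vimageD)
    qed
    then show "B \<in> sets X"
      using measurable_sets[OF measurable_state_description[OF singletons_in_sets[OF X]] A(1)] by simp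
  next
    fix B assume B: "B \<in> sets X"
    have "B = ?h ` (?h -` B \<inter> space ?S)"
    proof (intro set_eqI iffI)
      fix x assume "x \<in> B"
      then have "x \<in> space X" using sets.sets_into_space[OF B] by auto
      then show "x \<in> ?h ` (?h -` B \<inter> space ?S)"
        using \<open>x \<in> B\<close> k(1,2) by (intro image_eqI[of _ _ "state_description (space X) x"]) auto
    qed auto
    then show "B \<in> (`) ?h ` sets ?S"
      using measurable_sets[OF measurable_state_of[OF X] B] by blast
  qed
qed

section \<open>Universality\<close>

lemma identify_states_simps:
  "states (identify_states h T) = sigma (h ` space (states T)) ((`) h ` sets (states T))"
  "types (identify_states h T) = types T"
  "belief (identify_states h T) i t =
     distr (belief T i t) (joint (identify_states h T)) (map_prod h id)"
  by (simp_all add: identify_states_def Let_def joint_def)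

lemma measurable_map_states:
  assumes "h \<in> states T \<rightarrow>\<^sub>M states U" "types U = types T"
  shows "map_prod h id \<in> joint T \<rightarrow>\<^sub>M joint U"
  using measurable_compose[OF measurable_state_coordinate assms(1)] measurable_type_coordinate[of _ T]
  by (intro measurable_into_joint) (simp_all add: assms(2))

lemma type_space_identify_states:
  fixes T :: "('x, 'i::finite, 't) type_structure"
  assumes T: "type_space T" and h: "h \<in> states T \<rightarrow>\<^sub>M states (identify_states h T)"
  shows "type_space (identify_states h T)"
  unfolding type_space_def
proof (intro allI conjI ballI)
  let ?U = "identify_states h T"
  note meas = measurable_map_states[OF h identify_states_simps(2)]
  fix i
  have "belief T i \<in> types T i \<rightarrow>\<^sub>M prob_algebra (joint T)"
    using T unfolding type_space_def by blast
  then have "(\<lambda>t. distr (belief T i t) (joint ?U) (map_prod h id)) \<in> types T i \<rightarrow>\<^sub>M prob_algebra (joint ?U)"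
    by (rule measurable_compose) (rule measurable_distr_prob_space[OF meas])
  then show "belief ?U i \<in> types ?U i \<rightarrow>\<^sub>M prob_algebra (joint ?U)"
    by (subst measurable_cong[of _ _ "\<lambda>t. distr (belief T i t) (joint ?U) (map_prod h id)"])
       (simp_all add: identify_states_simps)
  fix t assume t: "t \<in> space (types ?U i)"
  then have t: "t \<in> space (types T i)" by (simp add: identify_states_simps)
  note belief_sets = type_space_belief(2)[OF T t]
  have "map_prod h id \<in> belief T i t \<rightarrow>\<^sub>M joint ?U"
    unfolding measurable_cong_sets[OF belief_sets refl] by (rule meas)
  moreover have "(\<lambda>z. snd z i) \<in> joint ?U \<rightarrow>\<^sub>M types T i"
    using measurable_type_coordinate[of i ?U] by (simp add: identify_states_simps)
  \<comment> \<open>The identification changes the state only, so the own-type coordinate and its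
    marginal are preserved.\<close>
  ultimately have "distr (belief ?U i t) (types T i) (\<lambda>z. snd z i) =
      distr (belief T i t) (types T i) (\<lambda>z. snd z i)"
    by (simp add: identify_states_simps(3) distr_distr comp_def)
  then show "distr (belief ?U i t) (types ?U i) (\<lambda>z. snd z i) = return (types ?U i) t"
    using T t by (simp add: type_space_def identify_states_simps)
qed

text \<open>A type carries a probability measure on the joint space, which is therefore inhabited;
  overwriting one coordinate places the given type in some world. Statements about types thus become
  statements about worlds, and agents without types cause no trouble.\<close>

lemma type_space_joint_nonempty:
  fixes T :: "('x, 'i::finite, 't) type_structure"
  assumes T: "type_space T" and t: "t \<in> space (types T i)"
  obtains z where "z \<in> space (joint T)" "snd z i = t"
proof -
  obtain z where z: "z \<in> space (joint T)"
    using prob_space.not_empty[OF type_space_belief(1)[OF T t]] type_space_belief(3)[OF T t] by auto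
  then have "(fst z, (snd z)(i := t)) \<in> space (joint T)"
    using t by (auto simp: space_joint PiE_iff)
  then show ?thesis using that by fastforce
qed

lemma type_space_model_partition:
  fixes T :: "('x, 'i::finite, 't) type_structure"
  assumes T: "type_space T" and nonempty: "space (joint T) \<noteq> {}"
    and sets: "\<And>x. x \<in> space (states T) \<Longrightarrow> {x} \<in> sets (states T)"
  shows "type_space_model (\<lambda>x. {x}) T \<in> partition_models (space (states T))"
proof -
  obtain y where y: "y \<in> space (joint T)" using nonempty by auto
  have model: "probability_model (space (states T)) (type_space_model (\<lambda>x. {x}) T)"
  proof (rule probability_model_type_space_model[OF T])
    fix x assume "x \<in> space (states T)"
    from measurable_sets[OF measurable_state_coordinate sets[OF this]]
    show "{z \<in> space (joint T). fst z \<in> {x}} \<in> sets (joint T)"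
      by (simp add: vimage_def Int_def conj_commute)
  qed
  \<comment> \<open>The type profile of a single world can be combined with any state, so every
    block of the partition is inhabited.\<close>
  have mem: "(x, snd y) \<in> {z \<in> space (joint T). fst z = x}" if "x \<in> space (states T)" for x
    using that y by (auto simp: space_joint)
  have "inj_on (\<lambda>x. {z \<in> space (joint T). fst z = x}) (space (states T))"
  proof (rule inj_onI)
    fix x x' assume "x \<in> space (states T)"
      and "{z \<in> space (joint T). fst z = x} = {z \<in> space (joint T). fst z = x'}"
    then have "(x, snd y) \<in> {z \<in> space (joint T). fst z = x'}" using mem by blast
    then show "x = x'" by simp
  qed
  moreover have "partition_on (space (joint T)) ((\<lambda>x. {z \<in> space (joint T). fst z = x}) ` space (states T))"
  proof (rule partition_onI)
    show "\<Union>((\<lambda>x. {z \<in> space (joint T). fst z = x}) ` space (states T)) = space (joint T)"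
      by (auto simp: space_joint)
    show "{} \<notin> (\<lambda>x. {z \<in> space (joint T). fst z = x}) ` space (states T)" using mem by blast
  qed (auto simp: disjnt_def)
  ultimately show ?thesis
    using model by (simp add: partition_models_def type_space_model_def)
qed

lemma ex1_type_morphism:
  fixes X :: "'x measure" and T :: "('x, 'i::finite, 't) type_structure"
  defines "U \<equiv> identify_states (state_of (space X)) 
      (formula_space (space X) :: (('x, 'i) formula set, 'i, ('x, 'i) formula set) type_structure)"
  assumes X: "sets X = sigma_sets (space X) {{x} | x. x \<in> space X}"
    and states_U: "sets (states U) = sets X"
    and T: "type_space T" "sets (states T) = sets X"
  shows "\<exists>!f. type_morphism T U f"
proof -
  let ?\<Phi> = "space X" and ?J = "formula_joint (space X) :: (('x, 'i) formula set \<times> ('i \<Rightarrow> ('x, 'i) formula set)) measure"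
  let ?F = "formula_space (space X) :: (('x, 'i) formula set, 'i, ('x, 'i) formula set) type_structure"
  let ?h = "state_of (space X) :: ('x, 'i) formula set \<Rightarrow> 'x"
  let ?k = "state_description (space X) :: 'x \<Rightarrow> ('x, 'i) formula set"
  define N where "N = type_space_model (\<lambda>x. {x}) T"
  define th where "th = theory_of (space X) {0..1} N"
  \<comment> \<open>The choice of \<open>z\<close> is immaterial by \<open>parts_th_cong\<close>;
    outside the carrier the value is \<open>undefined\<close>, as the extensional function space
    demands.\<close>
  define f where "f i = (\<lambda>t \<in> space (types T i).
      snd (parts (th (SOME z. z \<in> space (joint T) \<and> snd z i = t))) i)" for i
  have space_T: "space (states T) = space X" and space_U: "space (states U) = space X"
    using sets_eq_imp_space_eq T(2) states_U by blast+
  have types_U: "types U = types ?F" by (simp add: U_def identify_states_simps)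
  have belief_U: "belief U i t = distr (belief ?F i t) (joint U) (map_prod ?h id)" for i t
    by (simp add: U_def identify_states_simps)
  have joint_U: "y \<in> space (joint U) \<longleftrightarrow> fst y \<in> space X \<and> (\<forall>i. snd y i \<in> space (types ?F i))" for y
    by (cases y) (simp add: space_joint space_U types_U PiE_iff)
  have states_F: "states ?F = formula_states (space X)" by (simp add: formula_space_def)
  have h_meas: "map_prod ?h id \<in> ?J \<rightarrow>\<^sub>M joint U"
  proof -
    have "?h \<in> states ?F \<rightarrow>\<^sub>M states U"
      unfolding states_F measurable_cong_sets[OF refl states_U] by (rule measurable_state_of[OF X])
    from measurable_map_states[OF this types_U] show ?thesis by (simp add: joint_formula_space)
  qed
  have k_meas: "map_prod ?k id \<in> joint U \<rightarrow>\<^sub>M ?J"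
  proof -
    have "?k \<in> states U \<rightarrow>\<^sub>M states ?F"
      unfolding states_F measurable_cong_sets[OF states_U refl]
      by (rule measurable_state_description[OF singletons_in_sets[OF X]])
    from measurable_map_states[OF this types_U[symmetric]] show ?thesis by (simp add: joint_formula_space)
  qed
  have N_worlds: "worlds N = joint T" and N_Pr: "Pr N i z = belief T i (snd z i)"
    and N_interp: "interp N p = {z \<in> space (joint T). fst z = p}" for i z p
    by (simp_all add: N_def)
  \<comment> \<open>Conditional on a world, since without worlds the blocks of the partition would
    be empty.\<close>
  have N: "N \<in> partition_models (space X)" if "z \<in> space (joint T)" for z
    using type_space_model_partition[OF T(1)] that T(2) singletons_in_sets[OF X]
    by (auto simp: N_def space_T)
  have th_W: "th z \<in> world_theories (space X)" if "z \<in> space (joint T)" for z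
    unfolding th_def by (rule theory_of_in_world_theories) (simp_all add: N[OF that] N_worlds that)
  have th_mem: "\<phi> \<in> th z \<longleftrightarrow> \<phi> \<in> full_language (space X) \<and> z \<in> truth_set N \<phi>" for \<phi> z
    by (simp add: th_def theory_of_def)
  have parts_th_cong: "snd (parts (th z)) i = snd (parts (th z')) i"
    if "z \<in> space (joint T)" "z' \<in> space (joint T)" "snd z i = snd z' i" for z z' i
  proof -
    have "Pr N i z = Pr N i z'" unfolding N_Pr that(3) ..
    then have "z \<in> truth_set N \<phi> \<longleftrightarrow> z' \<in> truth_set N \<phi>" if "\<phi> \<in> belief_formulas i" for \<phi>
      using that \<open>z \<in> _\<close> \<open>z' \<in> _\<close> by (intro truth_set_belief_cong) (simp_all add: N_worlds)
    then show ?thesis unfolding parts_def by (auto simp: th_mem)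
  qed
  have f_eq: "f i (snd z i) = snd (parts (th z)) i" if z: "z \<in> space (joint T)" for i z
  proof -
    let ?z = "SOME z'. z' \<in> space (joint T) \<and> snd z' i = snd z i"
    have some: "?z \<in> space (joint T) \<and> snd ?z i = snd z i" by (rule someI[of _ z]) (simp add: z)
    have "snd z i \<in> space (types T i)" using z by (auto simp: space_joint)
    then have "f i (snd z i) = snd (parts (th ?z)) i" unfolding f_def by (rule restrict_apply')
    also have "\<dots> = snd (parts (th z)) i" using some z by (intro parts_th_cong) blast+
    finally show ?thesis .
  qed
  have h_eq: "?h (fst (parts (th z))) = fst z" if z: "z \<in> space (joint T)" for z
    using z by (intro state_of_eq th_W) (auto simp: th_mem N_interp space_joint space_T)
  \<comment> \<open>The morphism factors through the theory map, the splitting and the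
    identification of states, so its measurability and its image measures reduce to those of the
    factors.\<close>
  have map_f: "map_prod ?h id (parts (th z)) = morphism_map f z" if z: "z \<in> space (joint T)" for z
    using f_eq[OF z] h_eq[OF z]
    unfolding morphism_map_def case_prod_beta by (intro prod_eqI) (simp_all add: fun_eq_iff)
  have "type_morphism T U f"
    unfolding type_morphism_def
  proof (intro conjI allI ballI)
    fix i
    show "f i \<in> space (types T i) \<rightarrow>\<^sub>E space (types U i)"
    proof (rule PiE_I)
      fix t assume "t \<in> space (types T i)"
      then obtain z where "z \<in> space (joint T)" "snd z i = t" by (rule type_space_joint_nonempty[OF T(1)])
      then show "f i t \<in> space (types U i)"
        using f_eq[of z i] th_W by (auto simp: types_U space_formula_types)
    qed (simp add: f_def)
    fix t E assume t: "t \<in> space (types T i)" and E: "E \<in> sets (joint U)"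
    obtain z where z: "z \<in> space (joint T)" "snd z i = t"
      using t by (rule type_space_joint_nonempty[OF T(1)])
    note th_meas = measurable_parts_theory_of[OF N[OF z(1)], folded th_def, unfolded N_worlds]
    have hE: "map_prod ?h id -` E \<inter> space ?J \<in> sets ?J" using h_meas E by (rule measurable_sets)
    have eq: "(\<lambda>v. parts (th v)) -` (map_prod ?h id -` E \<inter> space ?J) \<inter> space (joint T) =
        morphism_map f -` E \<inter> space (joint T)"
      using measurable_space[OF th_meas] by (auto simp flip: map_f)
    show "morphism_map f -` E \<inter> space (joint T) \<in> sets (joint T)"
      using measurable_sets[OF th_meas hE] by (simp only: eq)
    \<comment> \<open>The world \<open>z\<close> of \<open>N\<close> realises the type
      \<open>f i t\<close>, so the belief there may be computed from \<open>N\<close>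
      itself.\<close>
    have belief: "belief ?F i (f i t) = theory_measure (space X) N i z"
      using belief_formula_space_theory_of[OF N[OF z(1)], of z i] z f_eq[OF z(1), of i]
      by (simp add: N_worlds th_def)
    have "theory_measure (space X) N i z \<in> space (prob_algebra ?J)"
      using theory_measure_in[OF N[OF z(1)]] z by (simp add: N_worlds)
    then have sets_b: "sets (theory_measure (space X) N i z) = sets ?J"
      by (simp add: space_prob_algebra)
    have "measure (belief U i (f i t)) E = measure (theory_measure (space X) N i z) (map_prod ?h id -` E \<inter> space ?J)"
      unfolding belief_U belief
      using h_meas E sets_eq_imp_space_eq[OF sets_b]
      by (subst measure_distr) (auto simp: measurable_cong_sets[OF sets_b refl])
    also have "\<dots> = measure (belief T i t) (morphism_map f -` E \<inter> space (joint T))"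
      unfolding theory_measure_def th_def[symmetric] N_Pr z(2)
      using th_meas hE eq type_space_belief[OF T(1) t]
      by (subst measure_distr) (auto simp: measurable_cong_sets[OF type_space_belief(2)[OF T(1) t] refl])
    finally show "measure (belief U i (f i t)) E =
      measure (belief T i t) (morphism_map f -` E \<inter> space (joint T))" .
  qed
  moreover have "g = f" if g: "type_morphism T U g" for g
  proof -
    have g_ext: "g i \<in> space (types T i) \<rightarrow>\<^sub>E space (types U i)" for i
      using g unfolding type_morphism_def by blast
    have g_measure: "measure (belief U i (g i t)) E =
        measure (belief T i t) (morphism_map g -` E \<inter> space (joint T))"
      if "t \<in> space (types T i)" "E \<in> sets (joint U)" for i t E
      using g that unfolding type_morphism_def by blast
    \<comment> \<open>The image of \<open>z\<close> under the competing morphism, with its state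
      turned back into a description so that formulas can be evaluated at it.\<close>
    define G where "G z = map_prod ?k id (morphism_map g z)" for z
    have G: "fst (G z) = ?k (fst z)" "snd (G z) i = g i (snd z i)" for z i
      by (simp_all add: G_def morphism_map_def split: prod.split)
    have g_U: "morphism_map g z \<in> space (joint U)" if "z \<in> space (joint T)" for z
      using that g_ext unfolding joint_U
      by (auto simp: space_joint space_T types_U morphism_map_def split: prod.split
          intro: PiE_mem[OF g_ext, unfolded types_U] dest: PiE_mem)
    have G_J: "G z \<in> space ?J" if "z \<in> space (joint T)" for z
      unfolding G_def using k_meas g_U[OF that] by (rule measurable_space)
    \<comment> \<open>In the belief case the morphism equation replaces the measure of
      \<open>holding\<close> by that of its preimage under \<open>g\<close>, and the induction
      hypothesis says that this preimage is the truth set in \<open>N\<close>.\<close>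
    have holds_iff: "{z \<in> space (joint T). holds_at (G z) \<phi>} = truth_set N \<phi>"
      if "\<phi> \<in> full_language (space X)" for \<phi>
      using that
    proof (induction rule: language.induct)
      case (1 p)
      then show ?case
        by (auto simp: G N_interp space_joint space_T Prop_in_state_description)
    next
      case (2 \<phi>)
      then show ?case by (auto simp: N_worlds)
    next
      case (3 \<phi> \<psi>)
      then show ?case by auto
    next
      case (4 \<phi> \<theta> i)
      let ?E = "map_prod ?k id -` holding (space X) \<phi> \<inter> space (joint U)"
      have E: "?E \<in> sets (joint U)" using k_meas holding_in_sets[OF 4(1)] by (rule measurable_sets)
      have "Bel i \<theta> \<phi> \<in> g i (snd z i) \<longleftrightarrow> \<theta> \<le> measure (belief T i (snd z i)) (truth_set N \<phi>)"
        if z: "z \<in> space (joint T)" for z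
      proof -
        have t: "snd z i \<in> space (types T i)" using z by (auto simp: space_joint)
        let ?t = "g i (snd z i)"
        have "?t \<in> space (types ?F i)" using g_ext[of i] t by (auto simp: types_U)
        then have rep: "represents (space X) i ?t (belief ?F i ?t)" by (rule represents_belief_formula_space)
        then have sets_b: "sets (belief ?F i ?t) = sets ?J"
          by (simp add: represents_def space_prob_algebra)
        \<comment> \<open>\<open>?E\<close> is \<open>holding\<close> transported to
          \<open>U\<close>; pulling it back recovers the original event because \<open>?k\<close>
          inverts \<open>?h\<close> on descriptions.\<close>
        have "map_prod ?h id -` ?E \<inter> space ?J = holding (space X) \<phi>"
          using measurable_space[OF h_meas] state_description(3)[of _ "space X", where 'i = 'i]
          by (auto simp: holding_def formula_joint_def space_pair_measure)
        then have "measure (belief ?F i ?t) (holding (space X) \<phi>) = measure (belief U i ?t) ?E"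
          unfolding belief_U
          using h_meas E sets_eq_imp_space_eq[OF sets_b]
          by (subst measure_distr) (auto simp: measurable_cong_sets[OF sets_b refl])
        also have "\<dots> = measure (belief T i (snd z i)) (morphism_map g -` ?E \<inter> space (joint T))"
          by (rule g_measure[OF t E])
        also have "morphism_map g -` ?E \<inter> space (joint T) = truth_set N \<phi>"
          unfolding 4(3)[symmetric] using g_U G_J by (auto simp: holding_def G_def)
        finally show ?thesis using rep 4 unfolding represents_def by auto
      qed
      then show ?case by (auto simp: G N_worlds N_Pr)
    qed
    have "g i t = f i t" for i t
    proof (cases "t \<in> space (types T i)")
      case True
      then obtain z where z: "z \<in> space (joint T)" "snd z i = t"
        by (rule type_space_joint_nonempty[OF T(1)])
      have in_F: "g i t \<in> (\<lambda>D. snd (parts D) i) ` world_theories (space X)"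
        using g_ext[of i] True by (auto simp: types_U space_formula_types)
      have "\<phi> \<in> g i t \<longleftrightarrow> \<phi> \<in> f i t" if \<phi>: "\<phi> \<in> full_language (space X)" for \<phi>
      proof -
        have "\<phi> \<in> g i t \<longleftrightarrow> \<phi> \<in> belief_formulas i \<and> holds_at (G z) \<phi>"
          using holds_at_belief[OF \<phi>, of "G z" i] in_F z by (simp add: G)
        also have "\<dots> \<longleftrightarrow> \<phi> \<in> f i t"
          using holds_iff[OF \<phi>] z \<phi> f_eq[OF z(1), of i] by (auto simp: parts_def th_mem)
        finally show ?thesis .
      qed
      moreover have "g i t \<subseteq> full_language (space X)"
        using in_F by (auto simp: parts_def universal_worlds_def description_def)
      moreover have "f i t \<subseteq> full_language (space X)"
        using f_eq[OF z(1), of i] z by (auto simp: parts_def th_mem)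
      ultimately show ?thesis by blast
    next
      case False
      \<comment> \<open>Off the carrier both functions take the default value of the extensional
        function space.\<close>
      then show ?thesis using PiE_arb[OF g_ext False] by (simp add: f_def)
    qed
    then show "g = f" by blast
  qed
  ultimately show ?thesis by blast
qed

theorem theorem9:
  fixes X :: "'x measure"
    and M_bar :: "('x, 'i::finite) canonical_model"
    and T_bar :: "(('x, 'i) formula set, 'i, ('x, 'i) formula set) type_structure"
  assumes "sets X = sigma_sets (space X) {{x} | x. x \<in> space X}"
  defines "M_bar \<equiv> universal_model (space X) (partition_models (space X))"
  defines "T_bar \<equiv> type_space_of (space X) {0..1} M_bar"
  shows "bij_betw (state_of (space X)) (space (states T_bar)) (space X) \<and>
    universal_type_space TYPE('t) X (identify_states (state_of (space X)) T_bar)"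
proof -
  have T_bar: "T_bar = formula_space (space X)"
    unfolding T_bar_def M_bar_def by (rule type_space_of_universal_model)
  let ?h = "state_of (space X) :: ('x, 'i) formula set \<Rightarrow> 'x"
  have states: "states T_bar = formula_states (space X)" by (simp add: T_bar formula_space_def)
  have bij: "bij_betw ?h (space (states T_bar)) (space X)"
    unfolding states by (rule bij_betw_state_of)
  have "?h ` space (states T_bar) = space X" using bij by (simp add: bij_betw_def)
  then have sets: "sets (states (identify_states ?h T_bar)) = sets X"
    using image_state_of_sets[OF assms(1), where 'i = 'i]
    by (simp add: identify_states_simps states sets.sigma_sets_eq sets.space_closed)
  have "?h \<in> states T_bar \<rightarrow>\<^sub>M states (identify_states ?h T_bar)"
    unfolding measurable_cong_sets[OF refl sets] states by (rule measurable_state_of[OF assms(1)])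
  then have "type_space (identify_states ?h T_bar)"
    by (intro type_space_identify_states) (simp_all add: T_bar type_space_formula_space)
  then show ?thesis
    unfolding universal_type_space_def
    using bij sets ex1_type_morphism[OF assms(1), where 'i = 'i and 't = 't] by (simp add: T_bar)
qed

end
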